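(* Let $\theta$ be an inner function. A bounded antilinear operator $X:K_\theta\to K_\theta$ satisfies both operator equations $S_\theta^*X=XS_\theta$ and $S_\theta X=XS_\theta^*$ if and only if $X=\lambda C_\theta$ for some $\lambda\in\mathbb{C}$.
   Context: $H^2$ is the Hardy–Hilbert space of the unit disk, identified via boundary values with a closed subspace of $L^2=L^2(\mathbb{T})$. For an inner function $\theta$, the model space is $K_\theta=H^2\ominus\theta H^2$. The compressed shift is $S_\theta:K_\theta\to K_\theta$, $S_\theta f=P_\theta(zf)$, where $P_\theta$ is the orthogonal projection of $L^2$ onto $K_\theta$. The map $C_\theta:K_\theta\to K_\theta$ is the conjugation (antilinear isometric involution) given on $\mathbb{T}$ by $C_\theta(f)=\theta\,\bar z\,\bar f$. *)

theory Defs
  imports "HOL-Complex_Analysis.Complex_Analysis"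
begin

section \<open>The Hilbert space of square-integrable functions on the unit circle\<close>

text \<open>Normalized arc length on the unit circle, as a complete probability measure on the whole
  plane that is concentrated on the circle. Values of a function off the circle therefore do not
  affect its measurability, its integral, or its class modulo null sets.\<close>

definition circle_measure :: "complex measure" where
  "circle_measure = completion (distr (uniform_measure lborel {0..2 * pi}) borel cis)"

definition square_integrable :: "(complex \<Rightarrow> complex) \<Rightarrow> bool" where
  "square_integrable f \<longleftrightarrow>
     f \<in> borel_measurable circle_measure \<and> integrable circle_measure (\<lambda>z. (cmod (f z))\<^sup>2)"

interpretation circle: complete_measure circle_measure
  unfolding circle_measure_def by (rule completion.complete_measure_axioms)

lemma space_circle_measure [simp]: "space circle_measure = UNIV"
  by (simp add: circle_measure_def)

lemma circle_measurable_AE: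
  fixes f g :: "complex \<Rightarrow> 'b::topological_space"
  assumes "f \<in> borel_measurable circle_measure" "AE z in circle_measure. f z = g z"
  shows "g \<in> borel_measurable circle_measure"
proof (rule measurableI)
  fix A :: "'b set" assume A: "A \<in> sets borel"
  have "AE z in circle_measure. z \<in> f -` A \<longleftrightarrow> z \<in> g -` A"
    using assms(2) by auto
  moreover have "f -` A \<in> sets circle_measure"
    using measurable_sets[OF assms(1) A] by simp
  ultimately show "g -` A \<inter> space circle_measure \<in> sets circle_measure"
    using circle.in_sets_AE[of "f -` A" "g -` A"] by simp
qed auto

lemma circle_integral_cong_AE:
  fixes f g :: "complex \<Rightarrow> 'b::{banach, second_countable_topology}"
  assumes eq: "AE z in circle_measure. f z = g z"
  shows "integral\<^sup>L circle_measure f = integral\<^sup>L circle_measure g"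
proof (cases "f \<in> borel_measurable circle_measure")
  case True
  with eq show ?thesis
    by (intro integral_cong_AE circle_measurable_AE[OF _ eq])
next
  case False
  moreover have "AE z in circle_measure. g z = f z"
    using eq by eventually_elim simp
  ultimately have "g \<notin> borel_measurable circle_measure"
    using circle_measurable_AE by blast
  with False show ?thesis
    by (metis borel_measurable_integrable not_integrable_integral_eq)
qed

lemma square_integrable_zero [simp]: "square_integrable (\<lambda>_. 0)"
  by (simp add: square_integrable_def)

lemma square_integrable_add:
  assumes "square_integrable f" "square_integrable g"
  shows "square_integrable (\<lambda>z. f z + g z)"
proof -
  have [measurable]: "f \<in> borel_measurable circle_measure" "g \<in> borel_measurable circle_measure"
    using assms by (auto simp: square_integrable_def)
  have bound: "(cmod (a + b))\<^sup>2 \<le> 2 * (cmod a)\<^sup>2 + 2 * (cmod b)\<^sup>2" for a b :: complex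
  proof -
    have "(cmod (a + b))\<^sup>2 \<le> (cmod a + cmod b)\<^sup>2"
      by (intro power_mono norm_triangle_ineq) auto
    also have "\<dots> \<le> 2 * (cmod a)\<^sup>2 + 2 * (cmod b)\<^sup>2"
      using sum_squares_bound[of "cmod a" "cmod b"] by (simp add: power2_sum)
    finally show ?thesis .
  qed
  have "integrable circle_measure (\<lambda>z. 2 * (cmod (f z))\<^sup>2 + 2 * (cmod (g z))\<^sup>2)"
    using assms by (auto simp: square_integrable_def)
  then have "integrable circle_measure (\<lambda>z. (cmod (f z + g z))\<^sup>2)"
    by (rule Bochner_Integration.integrable_bound) (use bound in \<open>auto simp: abs_le_iff\<close>)
  then show ?thesis by (simp add: square_integrable_def)
qed

lemma square_integrable_scale:
  assumes "square_integrable f"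
  shows "square_integrable (\<lambda>z. c * f z)"
  using assms by (auto simp: square_integrable_def norm_mult power_mult_distrib)

lemma square_integrable_cnj:
  assumes "square_integrable f"
  shows "square_integrable (\<lambda>z. cnj (f z))"
proof -
  have [measurable]: "f \<in> borel_measurable circle_measure"
    using assms by (auto simp: square_integrable_def)
  have "cnj \<in> borel_measurable borel"
    by (intro borel_measurable_continuous_onI continuous_intros)
  then have "(\<lambda>z. cnj (f z)) \<in> borel_measurable circle_measure"
    by measurable
  then show ?thesis using assms by (simp add: square_integrable_def)
qed

lemma square_integrable_AE:
  assumes "square_integrable f" "AE z in circle_measure. f z = g z"
  shows "square_integrable g"
proof -
  have f [measurable]: "f \<in> borel_measurable circle_measure"
    using assms(1) by (auto simp: square_integrable_def)
  have g [measurable]: "g \<in> borel_measurable circle_measure"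
    using f assms(2) by (rule circle_measurable_AE)
  have "integrable circle_measure (\<lambda>z. (cmod (f z))\<^sup>2)
      \<longleftrightarrow> integrable circle_measure (\<lambda>z. (cmod (g z))\<^sup>2)"
    by (rule integrable_cong_AE) (use assms(2) in auto)
  with g assms(1) show ?thesis by (simp add: square_integrable_def)
qed

lemma integrable_mult_cnj:
  assumes "square_integrable f" "square_integrable g"
  shows "integrable circle_measure (\<lambda>z. f z * cnj (g z))"
proof -
  have [measurable]: "f \<in> borel_measurable circle_measure"
      "(\<lambda>z. cnj (g z)) \<in> borel_measurable circle_measure"
    using assms square_integrable_cnj[of g] by (auto simp: square_integrable_def)
  have "integrable circle_measure (\<lambda>z. (cmod (f z))\<^sup>2 + (cmod (g z))\<^sup>2)"
    using assms by (auto simp: square_integrable_def)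
  then show ?thesis
  proof (rule Bochner_Integration.integrable_bound)
    have "cmod a * cmod b \<le> (cmod a)\<^sup>2 + (cmod b)\<^sup>2" for a b :: complex
    proof -
      have "2 * (cmod a * cmod b) \<le> (cmod a)\<^sup>2 + (cmod b)\<^sup>2"
        using sum_squares_bound[of "cmod a" "cmod b"] by simp
      moreover have "0 \<le> cmod a * cmod b" by simp
      ultimately show ?thesis by linarith
    qed
    then show "AE z in circle_measure. norm (f z * cnj (g z))
        \<le> norm ((cmod (f z))\<^sup>2 + (cmod (g z))\<^sup>2)"
      by (auto simp: norm_mult)
  qed measurable
qed

quotient_type l2_circle = "complex \<Rightarrow> complex" / partial:
  "\<lambda>f g. square_integrable f \<and> square_integrable g \<and> (AE z in circle_measure. f z = g z)"
proof (rule part_equivpI)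
  show "\<exists>f. square_integrable f \<and> square_integrable f \<and> (AE z in circle_measure. f z = f z)"
    by (rule exI[of _ "\<lambda>_. 0"]) simp
next
  show "symp (\<lambda>f g. square_integrable f \<and> square_integrable g \<and>
      (AE z in circle_measure. f z = g z))"
    by (auto intro!: sympI elim!: eventually_mono)
next
  show "transp (\<lambda>f g. square_integrable f \<and> square_integrable g \<and>
      (AE z in circle_measure. f z = g z))"
  proof (rule transpI, elim conjE, intro conjI)
    fix f g h :: "complex \<Rightarrow> complex"
    assume "AE z in circle_measure. f z = g z" "AE z in circle_measure. g z = h z"
    then show "AE z in circle_measure. f z = h z"
      by eventually_elim simp
  qed assumption+
qed

lift_definition scaleC :: "complex \<Rightarrow> l2_circle \<Rightarrow> l2_circle" (infixr \<open>*\<^sub>C\<close> 75)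
  is "\<lambda>c f z. c * f z"
  by (auto intro: square_integrable_scale)

lift_definition cinner :: "l2_circle \<Rightarrow> l2_circle \<Rightarrow> complex"
  is "\<lambda>f g. integral\<^sup>L circle_measure (\<lambda>z. f z * cnj (g z))"
proof -
  fix f f' g g' :: "complex \<Rightarrow> complex"
  assume f: "square_integrable f \<and> square_integrable f' \<and> (AE z in circle_measure. f z = f' z)"
    and g: "square_integrable g \<and> square_integrable g' \<and> (AE z in circle_measure. g z = g' z)"
  show "integral\<^sup>L circle_measure (\<lambda>z. f z * cnj (g z))
      = integral\<^sup>L circle_measure (\<lambda>z. f' z * cnj (g' z))"
  proof (rule integral_cong_AE)
    show "AE z in circle_measure. f z * cnj (g z) = f' z * cnj (g' z)"
      using f g by auto
  qed (use f g integrable_mult_cnj in \<open>auto dest: borel_measurable_integrable\<close>)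
qed

instantiation l2_circle :: real_vector
begin

lift_definition zero_l2_circle :: l2_circle is "\<lambda>_. 0"
  by simp

lift_definition plus_l2_circle :: "l2_circle \<Rightarrow> l2_circle \<Rightarrow> l2_circle" is "\<lambda>f g z. f z + g z"
  by (auto intro: square_integrable_add)

lift_definition uminus_l2_circle :: "l2_circle \<Rightarrow> l2_circle" is "\<lambda>f z. - f z"
  using square_integrable_scale[of _ "-1"] by auto

definition minus_l2_circle :: "l2_circle \<Rightarrow> l2_circle \<Rightarrow> l2_circle" where
  "minus_l2_circle f g = f + - g"

definition scaleR_l2_circle :: "real \<Rightarrow> l2_circle \<Rightarrow> l2_circle" where
  "scaleR_l2_circle r f = of_real r *\<^sub>C f"

instance
proof
  fix f g h :: l2_circle and r s :: real
  show "f + g + h = f + (g + h)"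
    by transfer (auto intro!: square_integrable_add simp: add.assoc)
  show "f + g = g + f"
    by transfer (auto intro!: square_integrable_add simp: add.commute)
  show "0 + f = f"
    by transfer auto
  show "- f + f = 0"
    by transfer (auto intro!: square_integrable_add square_integrable_scale[of _ "-1", simplified])
  show "f - g = f + - g"
    by (rule minus_l2_circle_def)
  show "r *\<^sub>R (f + g) = r *\<^sub>R f + r *\<^sub>R g"
    unfolding scaleR_l2_circle_def
    by transfer (auto intro!: square_integrable_add square_integrable_scale simp: distrib_left)
  show "(r + s) *\<^sub>R f = r *\<^sub>R f + s *\<^sub>R f"
    unfolding scaleR_l2_circle_def
    by transfer (auto intro!: square_integrable_add square_integrable_scale simp: distrib_right)
  show "r *\<^sub>R s *\<^sub>R f = (r * s) *\<^sub>R f"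
    unfolding scaleR_l2_circle_def
    by transfer (auto intro!: square_integrable_scale simp: mult.assoc)
  show "1 *\<^sub>R f = f"
    unfolding scaleR_l2_circle_def by transfer auto
qed

end

lemma cinner_commute: "cinner f g = cnj (cinner g f)"
proof transfer
  fix f g :: "complex \<Rightarrow> complex"
  have "integral\<^sup>L circle_measure (\<lambda>z. cnj (g z * cnj (f z)))
      = cnj (integral\<^sup>L circle_measure (\<lambda>z. g z * cnj (f z)))"
    by (rule Bochner_Integration.integral_cnj)
  then show "integral\<^sup>L circle_measure (\<lambda>z. f z * cnj (g z))
      = cnj (integral\<^sup>L circle_measure (\<lambda>z. g z * cnj (f z)))"
    by (simp add: mult.commute)
qed

lemma cinner_add_left: "cinner (f + g) h = cinner f h + cinner g h"
  by transfer (simp add: distrib_right integrable_mult_cnj)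

lemma cinner_scaleC_left: "cinner (c *\<^sub>C f) g = c * cinner f g"
  by transfer (simp add: mult.assoc)

lemma cinner_self: "cinner f f = of_real (Re (cinner f f)) \<and> 0 \<le> Re (cinner f f)"
proof transfer
  fix f :: "complex \<Rightarrow> complex"
  have "integral\<^sup>L circle_measure (\<lambda>z. f z * cnj (f z))
      = of_real (integral\<^sup>L circle_measure (\<lambda>z. (cmod (f z))\<^sup>2))"
    by (simp only: complex_norm_square[symmetric] integral_complex_of_real)
  moreover have "0 \<le> integral\<^sup>L circle_measure (\<lambda>z. (cmod (f z))\<^sup>2)" by simp
  ultimately show "integral\<^sup>L circle_measure (\<lambda>z. f z * cnj (f z))
      = of_real (Re (integral\<^sup>L circle_measure (\<lambda>z. f z * cnj (f z))))
      \<and> 0 \<le> Re (integral\<^sup>L circle_measure (\<lambda>z. f z * cnj (f z)))"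
    by simp
qed

lemma cinner_self_eq_0: "Re (cinner f f) = 0 \<longleftrightarrow> f = 0"
proof transfer
  fix f :: "complex \<Rightarrow> complex"
  assume "square_integrable f \<and> square_integrable f \<and> (AE z in circle_measure. f z = f z)"
  then have f: "square_integrable f" by simp
  have "integral\<^sup>L circle_measure (\<lambda>z. f z * cnj (f z))
      = of_real (integral\<^sup>L circle_measure (\<lambda>z. (cmod (f z))\<^sup>2))"
    by (simp only: complex_norm_square[symmetric] integral_complex_of_real)
  moreover have "integral\<^sup>L circle_measure (\<lambda>z. (cmod (f z))\<^sup>2) = 0
      \<longleftrightarrow> (AE z in circle_measure. (cmod (f z))\<^sup>2 = 0)"
    using f by (intro integral_nonneg_eq_0_iff_AE) (auto simp: square_integrable_def)
  ultimately show "Re (integral\<^sup>L circle_measure (\<lambda>z. f z * cnj (f z))) = 0 \<longleftrightarrow>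
      square_integrable f \<and> square_integrable (\<lambda>_. 0) \<and> (AE z in circle_measure. f z = 0)"
    using f by simp
qed

text \<open>The real inner product is the real part of the complex one; it induces the usual norm.\<close>

instantiation l2_circle :: real_inner
begin

definition inner_l2_circle :: "l2_circle \<Rightarrow> l2_circle \<Rightarrow> real" where
  "inner_l2_circle f g = Re (cinner f g)"

definition norm_l2_circle :: "l2_circle \<Rightarrow> real" where
  "norm_l2_circle f = sqrt (Re (cinner f f))"

definition sgn_l2_circle :: "l2_circle \<Rightarrow> l2_circle" where
  "sgn_l2_circle f = f /\<^sub>R norm f"

definition dist_l2_circle :: "l2_circle \<Rightarrow> l2_circle \<Rightarrow> real" where
  "dist_l2_circle f g = norm (f - g)"

definition uniformity_l2_circle :: "(l2_circle \<times> l2_circle) filter" where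
  "uniformity_l2_circle = (INF e\<in>{0<..}. principal {(f, g). dist f g < e})"

definition open_l2_circle :: "l2_circle set \<Rightarrow> bool" where
  "open_l2_circle U \<longleftrightarrow> (\<forall>f\<in>U. eventually (\<lambda>(f', g). f' = f \<longrightarrow> g \<in> U) uniformity)"

instance
proof
  fix f g h :: l2_circle and r :: real and U :: "l2_circle set"
  show "dist f g = norm (f - g)" by (rule dist_l2_circle_def)
  show "sgn f = f /\<^sub>R norm f" by (rule sgn_l2_circle_def)
  show "uniformity = (INF e\<in>{0<..}. principal {(f, g :: l2_circle). dist f g < e})"
    by (rule uniformity_l2_circle_def)
  show "open U \<longleftrightarrow> (\<forall>f\<in>U. eventually (\<lambda>(f', g). f' = f \<longrightarrow> g \<in> U) uniformity)"
    by (rule open_l2_circle_def)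
  show "f \<bullet> g = g \<bullet> f"
    unfolding inner_l2_circle_def by (subst cinner_commute) simp
  show "(f + g) \<bullet> h = f \<bullet> h + g \<bullet> h"
    by (simp add: inner_l2_circle_def cinner_add_left)
  show "(r *\<^sub>R f) \<bullet> g = r * (f \<bullet> g)"
    by (simp add: inner_l2_circle_def scaleR_l2_circle_def cinner_scaleC_left)
  show "0 \<le> f \<bullet> f"
    using cinner_self by (simp add: inner_l2_circle_def)
  show "f \<bullet> f = 0 \<longleftrightarrow> f = 0"
    by (simp add: inner_l2_circle_def cinner_self_eq_0)
  show "norm f = sqrt (f \<bullet> f)"
    by (simp add: inner_l2_circle_def norm_l2_circle_def)
qed

end

text \<open>Pointwise multiplication by a function on the circle. The product is again in the space
  when the multiplier is measurable and essentially bounded, as are all multipliers below;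
  otherwise it may fail to be, and then the value is 0 by convention.\<close>

lift_definition mult_by :: "(complex \<Rightarrow> complex) \<Rightarrow> l2_circle \<Rightarrow> l2_circle"
  is "\<lambda>u f. if square_integrable (\<lambda>z. u z * f z) then (\<lambda>z. u z * f z) else (\<lambda>_. 0)"
proof -
  fix u f g :: "complex \<Rightarrow> complex"
  assume fg: "square_integrable f \<and> square_integrable g \<and> (AE z in circle_measure. f z = g z)"
  have eq: "AE z in circle_measure. u z * f z = u z * g z"
    using fg by auto
  then have eq': "AE z in circle_measure. u z * g z = u z * f z"
    by eventually_elim (rule sym)
  have "square_integrable (\<lambda>z. u z * f z) \<longleftrightarrow> square_integrable (\<lambda>z. u z * g z)"
    using square_integrable_AE[OF _ eq] square_integrable_AE[OF _ eq'] by blast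
  with eq show "square_integrable
        (if square_integrable (\<lambda>z. u z * f z) then \<lambda>z. u z * f z else (\<lambda>_. 0)) \<and>
      square_integrable
        (if square_integrable (\<lambda>z. u z * g z) then \<lambda>z. u z * g z else (\<lambda>_. 0)) \<and>
      (AE z in circle_measure.
        (if square_integrable (\<lambda>z. u z * f z) then \<lambda>z. u z * f z else (\<lambda>_. 0)) z =
        (if square_integrable (\<lambda>z. u z * g z) then \<lambda>z. u z * g z else (\<lambda>_. 0)) z)"
    by simp
qed

lift_definition cnj_l2 :: "l2_circle \<Rightarrow> l2_circle" is "\<lambda>f z. cnj (f z)"
  by (auto intro: square_integrable_cnj)

text \<open>For a subspace \<open>K\<close>, the orthogonal projection onto \<open>K\<close> and the adjoint of a linear map of
  \<open>K\<close> into itself. Both are uniquely determined, and they exist when \<open>K\<close> is closed and, for the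
  adjoint, the map is bounded.\<close>

definition orth_proj :: "l2_circle set \<Rightarrow> l2_circle \<Rightarrow> l2_circle" where
  "orth_proj K f = (THE p. p \<in> K \<and> (\<forall>k\<in>K. cinner (f - p) k = 0))"

definition adjoint_on ::
    "l2_circle set \<Rightarrow> (l2_circle \<Rightarrow> l2_circle) \<Rightarrow> l2_circle \<Rightarrow> l2_circle" where
  "adjoint_on K T g = (THE h. h \<in> K \<and> (\<forall>f\<in>K. cinner (T f) g = cinner f h))"

definition bounded_antilinear_on :: "l2_circle set \<Rightarrow> (l2_circle \<Rightarrow> l2_circle) \<Rightarrow> bool" where
  "bounded_antilinear_on K X \<longleftrightarrow>
     (\<forall>f\<in>K. X f \<in> K) \<and>
     (\<forall>f\<in>K. \<forall>g\<in>K. X (f + g) = X f + X g) \<and>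
     (\<forall>c. \<forall>f\<in>K. X (c *\<^sub>C f) = cnj c *\<^sub>C X f) \<and>
     (\<exists>B. \<forall>f\<in>K. norm (X f) \<le> B * norm f)"


section \<open>Hardy space, inner functions and model spaces\<close>

definition hardy_disk :: "(complex \<Rightarrow> complex) set" where
  "hardy_disk = {F. F holomorphic_on ball 0 1 \<and>
     (\<exists>B. \<forall>r\<in>{0..<1::real}. (\<integral>z. (cmod (F (of_real r * z)))\<^sup>2 \<partial>circle_measure) \<le> B)}"

text \<open>The boundary function of an element \<open>F\<close> of the Hardy space of the disk is the limit in mean
  square of the dilations \<open>z \<mapsto> F (r z)\<close> as \<open>r\<close> tends to 1; it agrees almost everywhere with
  the radial limit of \<open>F\<close>.\<close>

lift_definition has_boundary_function :: "(complex \<Rightarrow> complex) \<Rightarrow> l2_circle \<Rightarrow> bool"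
  is "\<lambda>F f. ((\<lambda>r. \<integral>z. (cmod (F (of_real r * z) - f z))\<^sup>2 \<partial>circle_measure) \<longlongrightarrow> 0)
        (at_left (1::real))"
proof -
  fix F f g :: "complex \<Rightarrow> complex"
  assume fg: "square_integrable f \<and> square_integrable g \<and> (AE z in circle_measure. f z = g z)"
  have "(\<integral>z. (cmod (F (of_real r * z) - f z))\<^sup>2 \<partial>circle_measure)
      = (\<integral>z. (cmod (F (of_real r * z) - g z))\<^sup>2 \<partial>circle_measure)" for r :: real
    by (rule circle_integral_cong_AE) (use fg in auto)
  then show "((\<lambda>r. \<integral>z. (cmod (F (of_real r * z) - f z))\<^sup>2 \<partial>circle_measure) \<longlongrightarrow> 0) (at_left (1::real))
      \<longleftrightarrow> ((\<lambda>r. \<integral>z. (cmod (F (of_real r * z) - g z))\<^sup>2 \<partial>circle_measure) \<longlongrightarrow> 0) (at_left 1)"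
    by simp
qed

definition H2 :: "l2_circle set" where
  "H2 = {f. \<exists>F\<in>hardy_disk. has_boundary_function F f}"

definition inner_function :: "(complex \<Rightarrow> complex) \<Rightarrow> bool" where
  "inner_function \<theta> \<longleftrightarrow> \<theta> holomorphic_on ball 0 1 \<and> bounded (\<theta> ` ball 0 1) \<and>
     (AE z in circle_measure. \<exists>l. ((\<lambda>r. \<theta> (of_real r * z)) \<longlongrightarrow> l) (at_left (1::real)) \<and> cmod l = 1)"

definition radial_limit :: "(complex \<Rightarrow> complex) \<Rightarrow> complex \<Rightarrow> complex" where
  "radial_limit \<theta> z = Lim (at_left (1::real)) (\<lambda>r. \<theta> (of_real r * z))"

definition model_space :: "(complex \<Rightarrow> complex) \<Rightarrow> l2_circle set" where
  "model_space \<theta> = {f \<in> H2. \<forall>g\<in>H2. cinner f (mult_by (radial_limit \<theta>) g) = 0}"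

definition compressed_shift :: "(complex \<Rightarrow> complex) \<Rightarrow> l2_circle \<Rightarrow> l2_circle" where
  "compressed_shift \<theta> f = orth_proj (model_space \<theta>) (mult_by (\<lambda>z. z) f)"

definition model_conjugation :: "(complex \<Rightarrow> complex) \<Rightarrow> l2_circle \<Rightarrow> l2_circle" where
  "model_conjugation \<theta> f = mult_by (\<lambda>z. radial_limit \<theta> z * cnj z) (cnj_l2 f)"

end

theory Submission
  imports Defs
begin

text \<open>
  Write \<open>S\<close> for the compressed shift on the model space \<open>K\<close> and \<open>C\<close> for the conjugation.
  Since \<open>C\<close> is an antilinear involution of \<open>K\<close> that intertwines \<open>S\<close> with its adjoint
  (\<open>conjugation_shift\<close>), multiples of \<open>C\<close> satisfy both equations. Conversely, if \<open>X\<close> satisfies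
  them, then \<open>Y = C X\<close> is linear and commutes with \<open>S\<close> and with its adjoint, and it remains
  to see that such a \<open>Y\<close> is a scalar (\<open>commutant_scalar\<close>).

  This rests on explicit formulas. For \<open>f\<close> in \<open>K\<close>, \<open>S f\<close> is \<open>z f\<close> minus its component along
  \<open>\<theta>\<close> (\<open>compressed_shift_eq\<close>), and the adjoint of \<open>S\<close> is the backward shift
  \<open>f \<mapsto> (f - f(0)) / z\<close> (\<open>adjoint_compressed_shift\<close>). Hence \<open>I - S S\<^sup>*\<close> is the rank-one
  operator \<open>f \<mapsto> f(0) k\<close> with \<open>k\<close> the reproducing kernel at the origin
  (\<open>compressed_shift_backward_shift\<close>). As \<open>Y\<close> commutes with it, \<open>(Y f)(0) = c f(0)\<close> for a
  constant \<open>c\<close>; applying this to iterated backward shifts of \<open>f\<close> shows that \<open>Y\<close> multiplies every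
  Taylor coefficient by \<open>c\<close>, so \<open>Y f = c f\<close>.

  The analytic input is the description of the Hardy space by vanishing negative Fourier
  coefficients (\<open>mem_H2_iff\<close>), which in turn needs convergence of Fourier series in mean square
  (\<open>fourier_series_converges\<close>), that is, totality of the monomials (\<open>monomials_total\<close>).
\<close>


section \<open>Classes of square-integrable functions\<close>

lemma l2_circle_cases:
  obtains f where "square_integrable f" "F = abs_l2_circle f"
proof -
  have "\<exists>f. square_integrable f \<and> F = abs_l2_circle f"
    by (induction F rule: l2_circle.abs_induct) blast
  with that show thesis by blast
qed

lemma abs_l2_circle_eqI:
  assumes "square_integrable f" "AE z in circle_measure. f z = g z"
  shows "abs_l2_circle f = abs_l2_circle g"
  using assms square_integrable_AE[OF assms] by (intro Quotient_rel_abs[OF Quotient_l2_circle]) auto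

lemma cinner_class:
  assumes "square_integrable f" "square_integrable g"
  shows "cinner (abs_l2_circle f) (abs_l2_circle g) = (\<integral>z. f z * cnj (g z) \<partial>circle_measure)"
  using assms by (simp add: cinner.abs_eq)

lemma plus_class:
  assumes "square_integrable f" "square_integrable g"
  shows "abs_l2_circle f + abs_l2_circle g = abs_l2_circle (\<lambda>z. f z + g z)"
  using assms by (simp add: plus_l2_circle.abs_eq)

lemma scaleC_class:
  assumes "square_integrable f"
  shows "c *\<^sub>C abs_l2_circle f = abs_l2_circle (\<lambda>z. c * f z)"
  using assms by (simp add: scaleC.abs_eq)

lemma cnj_l2_class:
  assumes "square_integrable f"
  shows "cnj_l2 (abs_l2_circle f) = abs_l2_circle (\<lambda>z. cnj (f z))"
  using assms by (simp add: cnj_l2.abs_eq)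

lemma mult_by_class:
  assumes "square_integrable f" "square_integrable (\<lambda>z. u z * f z)"
  shows "mult_by u (abs_l2_circle f) = abs_l2_circle (\<lambda>z. u z * f z)"
  using assms by (simp add: mult_by.abs_eq)

lemma square_integrable_diff:
  assumes "square_integrable f" "square_integrable g"
  shows "square_integrable (\<lambda>z. f z - g z)"
  using square_integrable_add[OF assms(1) square_integrable_scale[OF assms(2), of "-1"]] by simp

lemma diff_class:
  assumes "square_integrable f" "square_integrable g"
  shows "abs_l2_circle f - abs_l2_circle g = abs_l2_circle (\<lambda>z. f z - g z)"
  using assms square_integrable_scale[OF assms(2), of "-1"]
  by (simp add: minus_l2_circle_def uminus_l2_circle.abs_eq plus_class)

lemma norm_class:
  assumes "square_integrable f"
  shows "(norm (abs_l2_circle f))\<^sup>2 = (\<integral>z. (cmod (f z))\<^sup>2 \<partial>circle_measure)"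
proof -
  have "cinner (abs_l2_circle f) (abs_l2_circle f)
      = of_real (\<integral>z. (cmod (f z))\<^sup>2 \<partial>circle_measure)"
    unfolding cinner_class[OF assms assms]
    by (simp only: complex_norm_square[symmetric] integral_complex_of_real)
  moreover have "0 \<le> (\<integral>z. (cmod (f z))\<^sup>2 \<partial>circle_measure)" by simp
  ultimately show ?thesis by (simp add: norm_l2_circle_def)
qed

lemma scaleC_add_right: "c *\<^sub>C (f + g) = c *\<^sub>C f + c *\<^sub>C g"
  by transfer (auto intro!: square_integrable_add square_integrable_scale simp: distrib_left)

lemma scaleC_add_left: "(c + d) *\<^sub>C f = c *\<^sub>C f + d *\<^sub>C f"
  by transfer (auto intro!: square_integrable_add square_integrable_scale simp: distrib_right)

lemma scaleC_scaleC: "c *\<^sub>C d *\<^sub>C f = (c * d) *\<^sub>C f"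
  by transfer (auto intro!: square_integrable_scale simp: mult.assoc)

lemma scaleC_one [simp]: "1 *\<^sub>C f = f"
  by transfer auto

lemma scaleC_zero_left [simp]: "0 *\<^sub>C f = 0"
  by transfer auto

lemma scaleC_minus_one: "(-1) *\<^sub>C f = - f"
  by transfer (auto intro: square_integrable_scale[of _ "-1", simplified])

lemma scaleC_zero_right [simp]: "c *\<^sub>C 0 = (0 :: l2_circle)"
  by transfer auto

lemma scaleC_diff_right: "c *\<^sub>C (f - g) = c *\<^sub>C f - c *\<^sub>C g"
  by (metis add_diff_cancel_right' diff_add_cancel scaleC_add_right)

lemma cinner_add_right: "cinner h (f + g) = cinner h f + cinner h g"
  by (subst (1 2 3) cinner_commute) (simp add: cinner_add_left)

lemma cinner_scaleC_right: "cinner g (c *\<^sub>C f) = cnj c * cinner g f"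
  by (subst (1 2) cinner_commute) (simp add: cinner_scaleC_left)

lemma cinner_zero_left [simp]: "cinner 0 f = 0"
  using cinner_scaleC_left[of 0 0 f] by simp

lemma cinner_zero_right [simp]: "cinner f 0 = 0"
  using cinner_scaleC_right[of f 0 0] by simp

lemma cinner_diff_left: "cinner (f - g) h = cinner f h - cinner g h"
  by (metis add_diff_cancel_right' cinner_add_left diff_add_cancel)

lemma cinner_diff_right: "cinner h (f - g) = cinner h f - cinner h g"
  by (metis add_diff_cancel_right' cinner_add_right diff_add_cancel)

lemma cinner_sum_left: "cinner (\<Sum>i\<in>A. f i) h = (\<Sum>i\<in>A. cinner (f i) h)"
  by (induction A rule: infinite_finite_induct) (auto simp: cinner_add_left)

lemma cinner_norm: "cinner f f = of_real ((norm f)\<^sup>2)"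
  using cinner_self[of f] by (simp add: norm_l2_circle_def)

lemma norm_scaleC: "norm (c *\<^sub>C f) = cmod c * norm f"
proof -
  obtain r where r: "cinner f f = of_real r" using cinner_self by metis
  have "Re (cinner (c *\<^sub>C f) (c *\<^sub>C f)) = (cmod c)\<^sup>2 * r"
    unfolding cinner_scaleC_left cinner_scaleC_right r cmod_power2
    by (simp add: power2_eq_square distrib_right)
  then show ?thesis
    unfolding norm_l2_circle_def r by (simp add: real_sqrt_mult)
qed

lemma cinner_eq_inner: "cinner f g = Complex (f \<bullet> g) (f \<bullet> (\<i> *\<^sub>C g))"
  by (simp add: complex_eq_iff inner_l2_circle_def cinner_scaleC_right)

lemma tendsto_cinner:
  assumes "(f \<longlongrightarrow> a) F"
  shows "((\<lambda>x. cinner (f x) g) \<longlongrightarrow> cinner a g) F"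
  unfolding cinner_eq_inner by (intro tendsto_intros assms)

lemma square_integrable_bounded_mult:
  assumes u: "u \<in> borel_measurable circle_measure" and B: "AE z in circle_measure. cmod (u z) \<le> B"
    and f: "square_integrable f"
  shows "square_integrable (\<lambda>z. u z * f z)"
proof -
  have [measurable]: "f \<in> borel_measurable circle_measure" "u \<in> borel_measurable circle_measure"
    using f u by (auto simp: square_integrable_def)
  have "integrable circle_measure (\<lambda>z. B\<^sup>2 * (cmod (f z))\<^sup>2)"
    using f by (simp add: square_integrable_def)
  then have "integrable circle_measure (\<lambda>z. (cmod (u z * f z))\<^sup>2)"
  proof (rule Bochner_Integration.integrable_bound)
    show "AE z in circle_measure. norm ((cmod (u z * f z))\<^sup>2) \<le> norm (B\<^sup>2 * (cmod (f z))\<^sup>2)"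
      using B by eventually_elim
        (auto simp: norm_mult power_mult_distrib intro!: mult_right_mono power_mono)
  qed measurable
  then show ?thesis by (simp add: square_integrable_def)
qed


section \<open>Normalized arc length\<close>

lemma measurable_cis [measurable]: "cis \<in> borel_measurable borel"
  by (rule borel_measurable_continuous_onI[OF continuous_on_cis[OF continuous_on_id]])

lemma emeasure_circle_measure: "emeasure circle_measure UNIV = 1"
proof -
  let ?U = "uniform_measure lborel {0..2 * pi}"
  have "emeasure (completion M) (space M) = emeasure M (space M)" for M :: "complex measure"
    by (simp only: emeasure_completion[OF sets_completionI_sets[OF sets.top]] main_part[OF sets.top])
  from this[of "distr ?U borel cis"]
  have "emeasure circle_measure UNIV = emeasure (distr ?U borel cis) UNIV"
    unfolding circle_measure_def space_distr space_borel .
  also have "\<dots> = emeasure ?U UNIV"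
    by (subst emeasure_distr) simp_all
  also have "\<dots> = 1"
    by (subst emeasure_uniform_measure) simp_all
  finally show ?thesis .
qed

lemma circle_integral:
  fixes f :: "complex \<Rightarrow> complex"
  assumes f [measurable]: "f \<in> borel_measurable borel"
  shows "(\<integral>z. f z \<partial>circle_measure) = (LBINT t. indicator {0..2 * pi} t *\<^sub>R f (cis t)) / (2 * pi)"
proof -
  have dens: "uniform_measure lborel {0..2 * pi}
      = density lborel (\<lambda>t. ennreal (indicator {0..2 * pi} t / (2 * pi)))"
    unfolding uniform_measure_def
    by (intro density_cong) (auto simp: indicator_def divide_ennreal[symmetric] ennreal_1[symmetric] simp del: ennreal_1)
  have "(\<integral>z. f z \<partial>circle_measure) = (\<integral>t. f (cis t) \<partial>uniform_measure lborel {0..2 * pi})"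
    unfolding circle_measure_def by (simp add: integral_completion integral_distr)
  also have "\<dots> = (LBINT t. (indicator {0..2 * pi} t / (2 * pi)) *\<^sub>R f (cis t))"
    unfolding dens by (intro integral_density) auto
  also have "\<dots> = (LBINT t. (1 / (2 * pi)) *\<^sub>R (indicator {0..2 * pi} t *\<^sub>R f (cis t)))"
    by (simp add: mult.commute)
  also have "\<dots> = (LBINT t. indicator {0..2 * pi} t *\<^sub>R f (cis t)) / (2 * pi)"
    by (subst integral_scaleR_right) (simp add: scaleR_conv_of_real)
  finally show ?thesis .
qed

lemma AE_circle: "AE z in circle_measure. cmod z = 1"
  unfolding circle_measure_def AE_completion_iff by (subst AE_distr_iff) auto

lemma sets_circle_measure: "A \<in> sets borel \<Longrightarrow> A \<in> sets circle_measure"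
  unfolding circle_measure_def by (rule sets_completionI_sets) simp

lemma borel_measurable_circle:
  fixes f :: "complex \<Rightarrow> 'b::topological_space"
  shows "f \<in> borel_measurable borel \<Longrightarrow> f \<in> borel_measurable circle_measure"
proof (rule measurableI)
  fix A :: "'b set" assume "f \<in> borel_measurable borel" "A \<in> sets borel"
  then have "f -` A \<in> sets borel" by (rule measurable_sets_borel)
  then show "f -` A \<inter> space circle_measure \<in> sets circle_measure"
    by (simp only: space_circle_measure Int_UNIV_right sets_circle_measure)
qed simp

lemma continuous_on_imp_circle_measurable:
  fixes f :: "complex \<Rightarrow> 'a::{topological_space, zero}"
  assumes "continuous_on (sphere 0 1) f"
  shows "f \<in> borel_measurable circle_measure"
proof -
  have "(\<lambda>z. if z \<in> sphere 0 1 then f z else 0) \<in> borel_measurable borel"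
    by (rule borel_measurable_continuous_on_if[OF borel_closed[OF closed_sphere] assms continuous_on_const])
  then show ?thesis
    by (rule circle_measurable_AE[OF borel_measurable_circle])
      (use AE_circle in \<open>eventually_elim, simp\<close>)
qed

interpretation circle: finite_measure circle_measure
  by (intro finite_measureI) (simp add: emeasure_circle_measure)

lemma measure_circle_measure: "measure circle_measure UNIV = 1"
  by (simp add: measure_def emeasure_circle_measure)

lemma square_integrable_const [simp]: "square_integrable (\<lambda>_. c)"
  by (simp add: square_integrable_def)

lemma square_integrable_bounded:
  assumes "f \<in> borel_measurable circle_measure" "AE z in circle_measure. cmod (f z) \<le> B"
  shows "square_integrable f"
  using square_integrable_bounded_mult[OF assms square_integrable_const[of 1]] by simp

lemma square_integrable_continuous_on:
  assumes "continuous_on (sphere 0 1) f"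
  shows "square_integrable f"
proof -
  have "bounded (f ` sphere 0 1)"
    by (intro compact_imp_bounded compact_continuous_image assms compact_sphere)
  then obtain B where "\<forall>x\<in>f ` sphere 0 1. norm x \<le> B"
    by (auto simp only: bounded_iff)
  then have B: "cmod (f z) \<le> B" if "z \<in> sphere 0 1" for z
    using that by blast
  show ?thesis
    by (rule square_integrable_bounded[OF continuous_on_imp_circle_measurable[OF assms], of B])
      (use AE_circle B in \<open>auto elim!: eventually_mono\<close>)
qed

text \<open>Every limit in mean square below is taken by this lemma. The dominating function \<open>w\<close> is only
  assumed square-integrable, not bounded, because simple functions approximating an arbitrary
  square-integrable function are dominated by a multiple of that function.\<close>

lemma l2_dominated_convergence:
  fixes w :: "complex \<Rightarrow> real"
  assumes s [measurable]: "\<And>n. s n \<in> borel_measurable circle_measure"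
    and f [measurable]: "f \<in> borel_measurable circle_measure"
    and w: "integrable circle_measure (\<lambda>z. (w z)\<^sup>2)"
    and lim: "AE z in circle_measure. (\<lambda>n. s n z) \<longlonglongrightarrow> f z"
    and bound: "\<And>n. AE z in circle_measure. cmod (s n z) \<le> w z"
  shows "square_integrable f" "(\<lambda>n. abs_l2_circle (s n)) \<longlonglongrightarrow> abs_l2_circle f"
proof -
  have bound': "AE z in circle_measure. \<forall>n. cmod (s n z) \<le> w z"
    using bound by (simp add: AE_all_countable)
  have bf: "AE z in circle_measure. cmod (f z) \<le> w z"
    using bound' lim
  proof eventually_elim
    case (elim z)
    then show ?case by (intro LIMSEQ_le_const2[OF tendsto_norm[of _ "f z"]]) auto
  qed
  have sq: "square_integrable h"
    if h [measurable]: "h \<in> borel_measurable circle_measure"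
      and "AE z in circle_measure. cmod (h z) \<le> w z" for h
  proof -
    have "integrable circle_measure (\<lambda>z. (cmod (h z))\<^sup>2)"
      by (rule Bochner_Integration.integrable_bound[OF w])
        (use that(2) in \<open>auto elim!: eventually_mono intro!: power_mono\<close>)
    then show ?thesis by (simp add: square_integrable_def)
  qed
  show sf: "square_integrable f" using sq[OF f bf] .
  have "(\<lambda>n. \<integral>z. (cmod (s n z - f z))\<^sup>2 \<partial>circle_measure) \<longlonglongrightarrow> (\<integral>z. 0 \<partial>circle_measure)"
  proof (rule integral_dominated_convergence)
    show "integrable circle_measure (\<lambda>z. 4 * (w z)\<^sup>2)" using w by simp
    show "AE z in circle_measure. (\<lambda>n. (cmod (s n z - f z))\<^sup>2) \<longlonglongrightarrow> 0"
      using lim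
    proof eventually_elim
      case (elim z)
      then have "(\<lambda>n. (cmod (s n z - f z))\<^sup>2) \<longlonglongrightarrow> (cmod (f z - f z))\<^sup>2"
        by (intro tendsto_intros)
      then show ?case by simp
    qed
    fix n
    show "AE z in circle_measure. norm ((cmod (s n z - f z))\<^sup>2) \<le> 4 * (w z)\<^sup>2"
      using bound[of n] bf
    proof eventually_elim
      case (elim z)
      have "cmod (s n z - f z) \<le> 2 * w z"
        using norm_triangle_ineq4[of "s n z" "f z"] elim by linarith
      then have "(cmod (s n z - f z))\<^sup>2 \<le> (2 * w z)\<^sup>2" by (intro power_mono) auto
      then show ?case by simp
    qed
  qed measurable
  then have "(\<lambda>n. (norm (abs_l2_circle (s n) - abs_l2_circle f))\<^sup>2) \<longlonglongrightarrow> 0"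
    using sq[OF s bound] sf by (simp add: diff_class norm_class square_integrable_diff)
  then have "(\<lambda>n. sqrt ((norm (abs_l2_circle (s n) - abs_l2_circle f))\<^sup>2)) \<longlonglongrightarrow> sqrt 0"
    by (intro tendsto_intros)
  then show "(\<lambda>n. abs_l2_circle (s n)) \<longlonglongrightarrow> abs_l2_circle f"
    by (simp add: LIM_zero_iff tendsto_norm_zero_iff)
qed



section \<open>Fourier series in mean square\<close>

definition monomial :: "int \<Rightarrow> l2_circle" where
  "monomial n = abs_l2_circle (\<lambda>z. z powi n)"

definition fourier_coeff :: "l2_circle \<Rightarrow> int \<Rightarrow> complex" where
  "fourier_coeff f n = cinner f (monomial n)"

definition fourier_partial :: "int set \<Rightarrow> l2_circle \<Rightarrow> l2_circle" where
  "fourier_partial A f = (\<Sum>n\<in>A. fourier_coeff f n *\<^sub>C monomial n)"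

lemma continuous_on_circle_powi [continuous_intros]:
  "continuous_on (sphere 0 1) (\<lambda>z::complex. z powi n)"
  by (intro continuous_intros) auto

lemma square_integrable_powi [simp]: "square_integrable (\<lambda>z. z powi n)"
  by (intro square_integrable_continuous_on continuous_intros)

lemma cnj_powi_circle:
  assumes "cmod z = 1"
  shows "cnj (z powi n) = z powi (- n)"
proof -
  have "z \<noteq> 0" using assms by auto
  have "z * cnj z = 1"
    using assms by (simp add: complex_norm_square[symmetric])
  then have "cnj z = inverse z"
    using \<open>z \<noteq> 0\<close> by (simp add: field_simps)
  then show ?thesis by (simp add: power_int_minus power_int_inverse)
qed

lemma circle_integral_powi: "(\<integral>z. z powi n \<partial>circle_measure) = (if n = 0 then 1 else 0)"
proof (cases "n = 0")
  case True
  then show ?thesis by (simp add: measure_circle_measure)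
next
  case False
  have [measurable]: "(\<lambda>z::complex. z powi n) \<in> borel_measurable borel"
    unfolding power_int_def by measurable
  define G where "G = (\<lambda>t. cis (of_int n * t) / (\<i> * of_int n))"
  have "(LBINT t. indicator {0..2 * pi} t *\<^sub>R cis (of_int n * t)) = G (2 * pi) - G 0"
  proof (rule integral_FTC_Icc)
    fix t :: real
    have "((\<lambda>t. exp (\<i> * of_real (of_int n * t)) / (\<i> * of_int n)) has_vector_derivative
        exp (\<i> * of_real (of_int n * t))) (at t within {0..2 * pi})"
      using False by (auto intro!: derivative_eq_intros has_vector_derivative_real_field simp: field_simps)
    then show "(G has_vector_derivative cis (of_int n * t)) (at t within {0..2 * pi})"
      by (simp add: G_def cis_conv_exp)
  qed (auto intro!: continuous_intros)
  also have "\<dots> = 0"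
    using cis_multiple_2pi[of "of_int n"] by (simp add: G_def mult.commute)
  finally have "(LBINT t. indicator {0..2 * pi} t *\<^sub>R (cis t) powi n) = 0"
    by (simp add: cis_power_int)
  with False show ?thesis by (subst circle_integral) auto
qed

lemma cinner_monomial: "cinner (monomial m) (monomial n) = (if m = n then 1 else 0)"
proof -
  have "cinner (monomial m) (monomial n) = (\<integral>z. z powi (m - n) \<partial>circle_measure)"
    unfolding monomial_def cinner_class[OF square_integrable_powi square_integrable_powi]
  proof (rule circle_integral_cong_AE)
    show "AE z in circle_measure. z powi m * cnj (z powi n) = z powi (m - n)"
      using AE_circle
    proof eventually_elim
      case (elim z)
      then have "z \<noteq> 0" by auto
      with cnj_powi_circle[OF elim, of n] show ?case
        by (simp flip: power_int_add)
    qed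
  qed
  then show ?thesis by (simp add: circle_integral_powi)
qed

lemma fourier_coeff_linear:
  "fourier_coeff (f + g) n = fourier_coeff f n + fourier_coeff g n"
  "fourier_coeff (f - g) n = fourier_coeff f n - fourier_coeff g n"
  "fourier_coeff (c *\<^sub>C f) n = c * fourier_coeff f n"
  "fourier_coeff 0 n = 0"
  "fourier_coeff (\<Sum>i\<in>I. h i) n = (\<Sum>i\<in>I. fourier_coeff (h i) n)"
  by (simp_all add: fourier_coeff_def cinner_add_left cinner_diff_left cinner_scaleC_left
      cinner_sum_left)

lemma fourier_coeff_monomial: "fourier_coeff (monomial m) n = (if m = n then 1 else 0)"
  by (simp add: fourier_coeff_def cinner_monomial)

lemma fourier_coeff_sum_monomial:
  assumes "finite A"
  shows "fourier_coeff (\<Sum>n\<in>A. a n *\<^sub>C monomial n) m = (if m \<in> A then a m else 0)"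
  using assms by (simp add: fourier_coeff_linear fourier_coeff_monomial if_distrib cong: if_cong)

lemma cinner_sum_monomial:
  "cinner (\<Sum>n\<in>A. a n *\<^sub>C monomial n) g = (\<Sum>n\<in>A. a n * cnj (fourier_coeff g n))"
  unfolding cinner_sum_left cinner_scaleC_left fourier_coeff_def
  by (intro sum.cong refl) (simp add: cinner_commute[of "monomial _" g])

lemma norm_sum_monomial:
  assumes "finite A"
  shows "(norm (\<Sum>n\<in>A. a n *\<^sub>C monomial n))\<^sup>2 = (\<Sum>n\<in>A. (cmod (a n))\<^sup>2)"
proof -
  have "cinner (\<Sum>n\<in>A. a n *\<^sub>C monomial n) (\<Sum>n\<in>A. a n *\<^sub>C monomial n)
      = of_real (\<Sum>n\<in>A. (cmod (a n))\<^sup>2)"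
    using assms
    by (subst cinner_sum_monomial) (auto simp: fourier_coeff_sum_monomial complex_norm_square
        simp del: of_real_power intro!: sum.cong)
  then show ?thesis unfolding cinner_norm by (simp only: of_real_eq_iff)
qed

lemma norm_fourier_partial_le:
  assumes "finite A"
  shows "norm (fourier_partial A f) \<le> norm f"
proof -
  define p where "p = fourier_partial A f"
  have "cinner p (f - p) = 0"
    using assms unfolding p_def fourier_partial_def cinner_sum_monomial
    by (auto simp: fourier_coeff_linear fourier_coeff_sum_monomial intro!: sum.neutral
        simp del: fourier_coeff_linear(5))
  then have "p \<bullet> (f - p) = 0" by (simp add: inner_l2_circle_def)
  then have "(norm (p + (f - p)))\<^sup>2 = (norm p)\<^sup>2 + (norm (f - p))\<^sup>2"
    by (intro norm_add_Pythagorean) (simp add: orthogonal_def)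
  then have "(norm p)\<^sup>2 \<le> (norm f)\<^sup>2" by simp
  then show ?thesis unfolding p_def by (rule power2_le_imp_le) simp
qed

lemma bessel_inequality:
  assumes "finite A"
  shows "(\<Sum>n\<in>A. (cmod (fourier_coeff f n))\<^sup>2) \<le> (norm f)\<^sup>2"
  using norm_fourier_partial_le[OF assms, of f] norm_sum_monomial[OF assms, of "fourier_coeff f"]
  by (metis fourier_partial_def norm_ge_zero power_mono)

lemma norm_fourier_coeff_le: "cmod (fourier_coeff f n) \<le> norm f"
  using bessel_inequality[of "{n}" f] by (auto intro: power2_le_imp_le)

text \<open>The rule \<open>cong\<close> ignores values off the circle. Without it the class would not be closed under
  products: \<open>z powi n * z powi m\<close> and \<open>z powi (n + m)\<close> may differ at 0.\<close>

inductive trig_poly :: "(complex \<Rightarrow> complex) \<Rightarrow> bool" where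
  monomial: "trig_poly (\<lambda>z. c * z powi n)"
| add: "trig_poly u \<Longrightarrow> trig_poly v \<Longrightarrow> trig_poly (\<lambda>z. u z + v z)"
| cong: "trig_poly u \<Longrightarrow> (\<And>z. cmod z = 1 \<Longrightarrow> u z = v z) \<Longrightarrow> trig_poly v"

lemma trig_poly_mult:
  assumes u: "trig_poly u" and v: "trig_poly v"
  shows "trig_poly (\<lambda>z. u z * v z)"
  using u
proof induction
  case (monomial c n)
  show ?case
    using v
  proof induction
    case (monomial d m)
    show ?case
    proof (rule trig_poly.cong[OF trig_poly.monomial])
      fix z :: complex assume "cmod z = 1"
      then have "z \<noteq> 0" by auto
      then show "(c * d) * z powi (n + m) = (c * z powi n) * (d * z powi m)"
        by (simp add: power_int_add)
    qed
  next
    case (add u v)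
    show ?case
      by (rule trig_poly.cong[OF trig_poly.add[OF add.IH]]) (simp add: distrib_left)
  next
    case (cong u v)
    show ?case
      by (rule trig_poly.cong[OF cong.IH]) (simp add: cong)
  qed
next
  case (add u v)
  show ?case
    by (rule trig_poly.cong[OF trig_poly.add[OF add.IH]]) (simp add: distrib_right)
next
  case (cong u v)
  show ?case
    by (rule trig_poly.cong[OF cong.IH]) (simp add: cong)
qed

text \<open>On the circle the conjugate of \<open>z\<close> is its inverse, so every real linear function of the
  plane restricts to a combination of \<open>z\<close> and \<open>z powi (-1)\<close>; products take care of the rest.\<close>

lemma trig_poly_real_polynomial:
  assumes "real_polynomial_function p"
  shows "trig_poly (\<lambda>z. of_real (p z))"
  using assms
proof induction
  case (linear f)
  then interpret bounded_linear f .
  define a where "a = (of_real (f 1) - \<i> * of_real (f \<i>)) / 2"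
  define b where "b = (of_real (f 1) + \<i> * of_real (f \<i>)) / 2"
  show ?case
  proof (rule trig_poly.cong[OF trig_poly.add[OF trig_poly.monomial trig_poly.monomial]])
    fix z :: complex assume z: "cmod z = 1"
    have "f z = f (Re z *\<^sub>R 1 + Im z *\<^sub>R \<i>)"
      by (rule arg_cong[of _ _ f]) (simp add: complex_eq_iff)
    also have "\<dots> = Re z * f 1 + Im z * f \<i>" by (simp only: local.add local.scale real_scaleR_def)
    finally have "f z = Re z * f 1 + Im z * f \<i>" .
    moreover have inv: "z powi (-1) = cnj z" using cnj_powi_circle[OF z, of 1] by simp
    ultimately show "a * z powi 1 + b * z powi (-1) = of_real (f z)"
      unfolding inv by (simp add: a_def b_def complex_eq_iff field_simps)
  qed
next
  case (const c)
  show ?case using trig_poly.monomial[of "of_real c" 0] by simp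
next
  case (add f g)
  then show ?case using trig_poly.add by simp
next
  case (mult f g)
  then show ?case using trig_poly_mult by simp
qed

text \<open>The trigonometric system is total. A closed subspace containing the monomials contains all
  trigonometric polynomials, hence by Stone--Weierstrass all real continuous functions, hence the
  indicators of closed sets as limits of continuous functions, hence by Dynkin's theorem those of
  Borel sets, then those of sets in the completion, then simple functions, then everything.\<close>

lemma monomials_total:
  assumes "closed V" and monom: "\<And>n. monomial n \<in> V"
    and scale: "\<And>c f. f \<in> V \<Longrightarrow> c *\<^sub>C f \<in> V"
    and add: "\<And>f g. f \<in> V \<Longrightarrow> g \<in> V \<Longrightarrow> f + g \<in> V"
  shows "f \<in> V"
proof -
  have lim: "f \<in> V" if "\<And>n. s n \<in> V" "s \<longlonglongrightarrow> f" for s f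
    using closed_sequentially[OF \<open>closed V\<close>] that by blast
  have trig: "square_integrable u \<and> abs_l2_circle u \<in> V" if "trig_poly u" for u
    using that
  proof induction
    case (monomial c n)
    show ?case
      using scale[OF monom[of n], of c]
      by (simp add: monomial_def scaleC_class square_integrable_scale)
  next
    case (add u v)
    then show ?case
      using \<open>\<And>f g. f \<in> V \<Longrightarrow> g \<in> V \<Longrightarrow> f + g \<in> V\<close>[of "abs_l2_circle u" "abs_l2_circle v"]
      by (simp add: plus_class square_integrable_add)
  next
    case (cong u v)
    have "AE z in circle_measure. u z = v z"
      using AE_circle by eventually_elim (rule cong.hyps)
    with cong.IH show ?case
      using abs_l2_circle_eqI square_integrable_AE by metis
  qed
  have cont: "abs_l2_circle (\<lambda>z. of_real (u z)) \<in> V"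
    if u: "continuous_on UNIV u" for u :: "complex \<Rightarrow> real"
  proof -
    have us: "continuous_on (sphere 0 1) u" using u continuous_on_subset by blast
    have "\<exists>p. real_polynomial_function p \<and> (\<forall>z\<in>sphere 0 1. \<bar>u z - p z\<bar> < 1 / real (Suc n))" for n
      using Stone_Weierstrass_real_polynomial_function[OF compact_sphere us, of "1 / real (Suc n)"]
      by (metis of_nat_0_less_iff zero_less_Suc zero_less_divide_1_iff)
    then obtain p where p: "\<And>n. real_polynomial_function (p n)"
      and close: "\<And>n z. z \<in> sphere 0 1 \<Longrightarrow> \<bar>u z - p n z\<bar> < 1 / real (Suc n)"
      by metis
    have "bounded (u ` sphere 0 1)"
      by (intro compact_imp_bounded compact_continuous_image us compact_sphere)
    then obtain B where B: "\<And>z. z \<in> sphere 0 1 \<Longrightarrow> \<bar>u z\<bar> \<le> B"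
      unfolding bounded_iff by (metis imageI real_norm_def)
    show ?thesis
    proof (rule lim)
      show "abs_l2_circle (\<lambda>z. of_real (p n z)) \<in> V" for n
        using trig[OF trig_poly_real_polynomial[OF p]] by blast
      show "(\<lambda>n. abs_l2_circle (\<lambda>z. of_real (p n z))) \<longlonglongrightarrow> abs_l2_circle (\<lambda>z. of_real (u z))"
      proof (rule l2_dominated_convergence(2))
        show "(\<lambda>z. complex_of_real (p n z)) \<in> borel_measurable circle_measure" for n
          using trig[OF trig_poly_real_polynomial[OF p, of n]] by (simp add: square_integrable_def)
        show "(\<lambda>z. complex_of_real (u z)) \<in> borel_measurable circle_measure"
          by (intro continuous_on_imp_circle_measurable continuous_intros us)
        show "integrable circle_measure (\<lambda>z. (B + 1)\<^sup>2)" by simp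
        show "AE z in circle_measure. (\<lambda>n. complex_of_real (p n z)) \<longlonglongrightarrow> of_real (u z)"
          using AE_circle
        proof eventually_elim
          case (elim z)
          have "(\<lambda>n. p n z - u z) \<longlonglongrightarrow> 0"
          proof (rule Lim_null_comparison[OF _ LIMSEQ_inverse_real_of_nat])
            show "\<forall>\<^sub>F n in sequentially. norm (p n z - u z) \<le> inverse (real (Suc n))"
              using close[of z] elim
              by (intro always_eventually allI)
                (simp add: abs_minus_commute less_imp_le inverse_eq_divide)
          qed
          then show ?case by (intro tendsto_of_real) (simp add: LIM_zero_iff)
        qed
        show "AE z in circle_measure. cmod (of_real (p n z)) \<le> B + 1" for n
          using AE_circle
        proof eventually_elim
          case (elim z)
          have "1 / real (Suc n) \<le> 1" by simp
          moreover have "\<bar>u z - p n z\<bar> < 1 / real (Suc n)" "\<bar>u z\<bar> \<le> B"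
            using close[of z n] B[of z] elim by auto
          ultimately have "\<bar>p n z\<bar> \<le> B + 1" by linarith
          then show ?case by simp
        qed
      qed
    qed
  qed
  have closed_set: "abs_l2_circle (indicator A) \<in> V" if "closed A" for A :: "complex set"
  proof (cases "A = {}")
    case True
    then show ?thesis using cont[of "\<lambda>_. 0"] by (simp add: indicator_def[abs_def])
  next
    case False
    \<comment> \<open>Continuous functions that equal 1 on \<open>A\<close> and vanish at distance at least \<open>1 / n\<close> from it.\<close>
    define u where "u = (\<lambda>(n::nat) z. max 0 (1 - real n * infdist z A))"
    have uc: "continuous_on S (u n)" for n S
      unfolding u_def by (intro continuous_intros)
    show ?thesis
    proof (rule lim)
      show "abs_l2_circle (\<lambda>z. of_real (u n z)) \<in> V" for n by (intro cont uc)
      show "(\<lambda>n. abs_l2_circle (\<lambda>z. of_real (u n z))) \<longlonglongrightarrow> abs_l2_circle (indicator A)"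
      proof (rule l2_dominated_convergence(2))
        show "(\<lambda>z. complex_of_real (u n z)) \<in> borel_measurable circle_measure" for n
          by (intro continuous_on_imp_circle_measurable continuous_intros uc)
        have "A \<in> sets circle_measure" using \<open>closed A\<close> by (intro sets_circle_measure) simp
        then show "indicator A \<in> borel_measurable circle_measure" by measurable
        show "integrable circle_measure (\<lambda>z. 1\<^sup>2 :: real)" by simp
        show "AE z in circle_measure. cmod (of_real (u n z)) \<le> 1" for n
          by (simp add: u_def infdist_nonneg)
        have "(\<lambda>n. u n z) \<longlonglongrightarrow> indicator A z" for z
        proof (cases "z \<in> A")
          case True
          then show ?thesis by (simp add: u_def)
        next
          case z: False
          have pos: "infdist z A > 0"
            by (rule infdist_pos_not_in_closed[OF \<open>closed A\<close> False z])
          obtain N where N: "1 / infdist z A < real N" using reals_Archimedean2 by blast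
          have "\<forall>\<^sub>F n in sequentially. u n z = 0"
            using eventually_ge_at_top[of N]
          proof eventually_elim
            case (elim n)
            then have "1 / infdist z A < real n" using N by simp
            then show ?case using pos by (simp add: u_def field_simps)
          qed
          then show ?thesis using z by (simp add: tendsto_eventually)
        qed
        then have "(\<lambda>n. complex_of_real (u n z)) \<longlonglongrightarrow> of_real (indicator A z)" for z
          by (rule tendsto_of_real)
        then show "AE z in circle_measure. (\<lambda>n. complex_of_real (u n z)) \<longlonglongrightarrow> indicator A z"
          by (simp only: of_real_indicator) (rule always_eventually, simp)
      qed
    qed
  qed
  have sq_ind: "square_integrable (indicator A)" if "A \<in> sets circle_measure" for A
    by (rule square_integrable_bounded[of _ 1]) (use that in \<open>auto simp: indicator_def\<close>)
  have borel_set: "abs_l2_circle (indicator A) \<in> V" if "A \<in> sets borel" for A :: "complex set"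
  proof -
    have "A \<in> sigma_sets UNIV (Collect closed)"
      using that unfolding borel_eq_closed by simp
    have sub: "sigma_sets UNIV (Collect closed) \<subseteq> sets circle_measure"
      using sets_circle_measure unfolding borel_eq_closed by auto
    have "Int_stable (Collect closed :: complex set set)" "Collect closed \<subseteq> Pow UNIV"
      by (auto simp: Int_stable_def)
    from this \<open>A \<in> sigma_sets UNIV (Collect closed)\<close> show ?thesis
    proof (induction rule: sigma_sets_induct_disjoint)
      case (basic A)
      then show ?case using closed_set by simp
    next
      case empty
      show ?case by (rule closed_set) simp
    next
      case (compl A)
      have sA: "square_integrable (indicator A)"
        using compl sub by (intro sq_ind) auto
      have "abs_l2_circle (\<lambda>z. 1 - indicator A z)
          = abs_l2_circle (\<lambda>z. 1) + (-1) *\<^sub>C abs_l2_circle (indicator A)"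
        using square_integrable_scale[OF sA, of "-1"] by (simp add: sA scaleC_class plus_class)
      also have "\<dots> \<in> V"
        by (intro add scale compl) (use cont[of "\<lambda>_. 1"] in simp)
      also have "(\<lambda>z. 1 - indicator A z) = (indicator (UNIV - A) :: complex \<Rightarrow> complex)"
        by (auto simp: indicator_def)
      finally show ?case .
    next
      case (union A)
      have meas [measurable]: "A i \<in> sets circle_measure" for i using union sub by auto
      have fin: "abs_l2_circle (indicator (\<Union>i<n. A i)) \<in> V" for n
      proof (induction n)
        case 0
        show ?case using closed_set[of "{}"] by (simp add: indicator_def[abs_def])
      next
        case (Suc n)
        have "A i \<inter> A n = {}" if "i < n" for i
          using \<open>disjoint_family A\<close> that by (auto simp: disjoint_family_on_def)
        then have "(\<Union>i<n. A i) \<inter> A n = {}" by blast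
        then have "(indicator (\<Union>i<Suc n. A i) :: complex \<Rightarrow> complex)
            = (\<lambda>z. indicator (\<Union>i<n. A i) z + indicator (A n) z)"
          by (auto simp: indicator_def lessThan_Suc fun_eq_iff)
        moreover have "square_integrable (indicator (\<Union>i<n. A i))" "square_integrable (indicator (A n))"
          by (auto intro!: sq_ind)
        ultimately show ?case using add[OF Suc union(3)[of n]] by (simp add: plus_class)
      qed
      show ?case
      proof (rule lim[OF fin l2_dominated_convergence(2)])
        show "indicator (\<Union>i<n. A i) \<in> borel_measurable circle_measure"
             "indicator (\<Union> (range A)) \<in> borel_measurable circle_measure" for n
          by measurable
        show "integrable circle_measure (\<lambda>z. 1\<^sup>2 :: real)" by simp
        show "AE z in circle_measure. cmod (indicator (\<Union>i<n. A i) z) \<le> 1" for n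
          by (simp add: indicator_def)
        show "AE z in circle_measure.
            (\<lambda>n. indicator (\<Union>i<n. A i) z :: complex) \<longlonglongrightarrow> indicator (\<Union> (range A)) z"
          by (intro always_eventually allI LIMSEQ_indicator_UN)
      qed
    qed
  qed
  have meas_set: "abs_l2_circle (indicator A) \<in> V" if A: "A \<in> sets circle_measure" for A
  proof -
    obtain B where B: "B \<in> sets borel" and AB: "AE z in circle_measure. z \<in> A \<longleftrightarrow> z \<in> B"
    proof -
      let ?M = "distr (uniform_measure lborel {0..2 * pi}) borel cis"
      from A obtain S N N' where S: "A = S \<union> N" "N \<subseteq> N'" "N' \<in> null_sets ?M" "S \<in> sets ?M"
        unfolding circle_measure_def by (rule sets_completionE)
      have "AE z in circle_measure. z \<notin> N'"
        unfolding circle_measure_def AE_completion_iff using S(3) by (rule AE_not_in)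
      then have "AE z in circle_measure. z \<in> A \<longleftrightarrow> z \<in> S"
        by eventually_elim (use S(1,2) in auto)
      then show thesis using that[of S] S(4) by simp
    qed
    have "AE z in circle_measure. (indicator A z :: complex) = indicator B z"
      using AB by eventually_elim (simp add: indicator_def)
    then have "abs_l2_circle (indicator A) = abs_l2_circle (indicator B)"
      by (rule abs_l2_circle_eqI[OF sq_ind[OF A]])
    then show ?thesis using borel_set[OF B] by simp
  qed
  have simple: "abs_l2_circle u \<in> V" if u: "simple_function circle_measure u" for u
  proof -
    have fin: "finite (range u)" and meas: "u -` {y} \<in> sets circle_measure" for y
      using simple_functionD[OF u] by auto
    define T where "T = (\<lambda>Y z. \<Sum>y\<in>Y. y * (indicator (u -` {y}) z :: complex))"
    have "square_integrable (T Y) \<and> abs_l2_circle (T Y) \<in> V" if "finite Y" for Y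
      using that
    proof induction
      case empty
      then show ?case using cont[of "\<lambda>_. 0"] by (simp add: T_def)
    next
      case (insert y Y)
      have T: "T (insert y Y) = (\<lambda>z. y * indicator (u -` {y}) z + T Y z)"
        unfolding T_def using insert.hyps by (intro ext sum.insert)
      have sq: "square_integrable (\<lambda>z. y * indicator (u -` {y}) z)"
        by (intro square_integrable_scale sq_ind meas)
      have "abs_l2_circle (\<lambda>z. y * indicator (u -` {y}) z) \<in> V"
        using scale[OF meas_set[OF meas[of y]], of y] by (simp only: scaleC_class sq_ind meas)
      then have "abs_l2_circle (\<lambda>z. y * indicator (u -` {y}) z) + abs_l2_circle (T Y) \<in> V"
        using insert.IH by (intro add) auto
      then show ?case
        unfolding T using insert.IH sq by (simp only: plus_class square_integrable_add simp_thms)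
    qed
    moreover have "T (range u) = u"
    proof
      fix z
      have "T (range u) z = (\<Sum>y\<in>range u. if y = u z then y else 0)"
        unfolding T_def by (intro sum.cong refl) (simp add: indicator_def)
      also have "\<dots> = u z" by (subst sum.delta[OF fin]) simp
      finally show "T (range u) z = u z" .
    qed
    ultimately show ?thesis using fin by metis
  qed
  obtain h where h: "square_integrable h" "f = abs_l2_circle h" by (rule l2_circle_cases)
  then have hm: "h \<in> borel_measurable circle_measure" by (simp add: square_integrable_def)
  from borel_measurable_implies_sequence_metric[OF hm, of 0] obtain s where
    s: "\<And>i. simple_function circle_measure (s i)" "\<And>z. (\<lambda>i. s i z) \<longlonglongrightarrow> h z"
       "\<And>i z. cmod (s i z) \<le> 2 * cmod (h z)"
    by auto
  show ?thesis
    unfolding h(2)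
  proof (rule lim)
    show "abs_l2_circle (s n) \<in> V" for n by (rule simple[OF s(1)])
    show "(\<lambda>n. abs_l2_circle (s n)) \<longlonglongrightarrow> abs_l2_circle h"
    proof (rule l2_dominated_convergence(2))
      show "s n \<in> borel_measurable circle_measure" for n
        using s(1) by (rule borel_measurable_simple_function)
      show "integrable circle_measure (\<lambda>z. (2 * cmod (h z))\<^sup>2)"
        using h by (simp add: square_integrable_def power_mult_distrib)
    qed (use s hm in auto)
  qed
qed

lemma scaleC_diff_left: "(c - d) *\<^sub>C f = c *\<^sub>C f - d *\<^sub>C f"
  by (metis add_diff_cancel_right' diff_add_cancel scaleC_add_left)

lemma scaleC_sum_right: "c *\<^sub>C (\<Sum>i\<in>I. f i) = (\<Sum>i\<in>I. c *\<^sub>C f i)"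
  by (induction I rule: infinite_finite_induct) (auto simp: scaleC_add_right)

lemma tendsto_scaleC:
  assumes "(f \<longlongrightarrow> a) F"
  shows "((\<lambda>x. c *\<^sub>C f x) \<longlongrightarrow> c *\<^sub>C a) F"
proof -
  have "bounded_linear (scaleC c)"
    by (rule bounded_linear_intro[of _ "cmod c"])
      (simp_all add: scaleC_add_right scaleR_l2_circle_def scaleC_scaleC mult.commute norm_scaleC)
  then show ?thesis using assms by (rule bounded_linear.tendsto)
qed

text \<open>The partial sum operators are contractions, so the set of all \<open>f\<close> for which the series
  converges to \<open>f\<close> is a closed subspace. It contains the monomials, whose partial sums are
  eventually constant; totality of the monomials finishes the proof.\<close>

theorem fourier_series_converges:
  "(\<lambda>N. fourier_partial {- int N..int N} f) \<longlonglongrightarrow> f"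
proof -
  define P where "P = (\<lambda>N. fourier_partial {- int N..int N})"
  define V where "V = {f. (\<lambda>N. P N f) \<longlonglongrightarrow> f}"
  have P_add: "P N (f + g) = P N f + P N g" and P_diff: "P N (f - g) = P N f - P N g"
    and P_scale: "P N (c *\<^sub>C f) = c *\<^sub>C P N f" for N f g c
    by (simp_all add: P_def fourier_partial_def fourier_coeff_linear scaleC_add_left
        scaleC_diff_left sum.distrib sum_subtractf scaleC_sum_right scaleC_scaleC)
  have P_norm: "norm (P N f) \<le> norm f" for N f
    unfolding P_def by (rule norm_fourier_partial_le) simp
  have "f \<in> V"
  proof (rule monomials_total)
    fix n
    have "\<forall>\<^sub>F N in sequentially. P N (monomial n) = monomial n"
      using eventually_ge_at_top[of "nat \<bar>n\<bar>"]
    proof eventually_elim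
      case (elim N)
      have "P N (monomial n) = (\<Sum>m\<in>{- int N..int N}. if m = n then monomial m else 0)"
        unfolding P_def fourier_partial_def
        by (intro sum.cong refl) (simp add: fourier_coeff_monomial)
      also have "\<dots> = monomial n" using elim by (subst sum.delta) auto
      finally show ?case .
    qed
    then show "monomial n \<in> V" unfolding V_def by (simp add: tendsto_eventually)
  next
    show "f + g \<in> V" if "f \<in> V" "g \<in> V" for f g
      using that by (auto simp: V_def P_add intro: tendsto_add)
    show "c *\<^sub>C f \<in> V" if "f \<in> V" for f c
      using that by (auto simp: V_def P_scale intro: tendsto_scaleC)
    show "closed V"
      unfolding closed_sequential_limits
    proof (intro allI impI, elim conjE)
      fix x l assume x: "\<forall>n. x n \<in> V" and l: "x \<longlonglongrightarrow> l"
      have "(\<lambda>N. P N l) \<longlonglongrightarrow> l"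
      proof (rule LIMSEQ_I)
        fix e :: real assume "e > 0"
        then have e: "e / 3 > 0" by simp
        from LIMSEQ_D[OF l e] obtain m where m: "norm (x m - l) < e / 3" by blast
        have "(\<lambda>N. P N (x m)) \<longlonglongrightarrow> x m" using x by (auto simp: V_def)
        from LIMSEQ_D[OF this e] obtain N0 where
          N0: "\<And>N. N \<ge> N0 \<Longrightarrow> norm (P N (x m) - x m) < e / 3" by blast
        have "norm (P N l - l) < e" if "N \<ge> N0" for N
        proof -
          have "P N l - l = (P N (x m) - x m) + (x m - l) - P N (x m - l)"
            by (simp add: P_diff)
          then have "norm (P N l - l)
              \<le> norm (P N (x m) - x m) + norm (x m - l) + norm (P N (x m - l))"
            by (metis norm_triangle_ineq norm_triangle_ineq4 add_right_mono order_trans)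
          then show ?thesis using N0[OF that] m P_norm[of N "x m - l"] by linarith
        qed
        then show "\<exists>N0. \<forall>N\<ge>N0. norm (P N l - l) < e" by blast
      qed
      then show "l \<in> V" by (simp add: V_def)
    qed
  qed
  then show ?thesis by (simp add: V_def P_def)
qed

text \<open>The form in which Parseval's identity is needed: all orthogonality relations in the model
  space come from two functions having no common frequency.\<close>

lemma cinner_eq_0_if_disjoint_spectra:
  assumes "\<And>n. fourier_coeff f n = 0 \<or> fourier_coeff g n = 0"
  shows "cinner f g = 0"
proof -
  have "cinner (fourier_partial A f) g = 0" for A
    unfolding fourier_partial_def cinner_sum_monomial using assms by (intro sum.neutral) auto
  then have "(\<lambda>N::nat. 0 :: complex) \<longlonglongrightarrow> cinner f g"
    using tendsto_cinner[OF fourier_series_converges, of f g] by simp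
  then show ?thesis by (simp add: LIMSEQ_const_iff)
qed

lemma fourier_coeff_unique:
  assumes "\<And>n. fourier_coeff f n = 0"
  shows "f = 0"
  using cinner_eq_0_if_disjoint_spectra[of f f] assms by (simp add: cinner_norm)



section \<open>The Hardy space as a space of Fourier series\<close>

lemma norm_nat_sum_monomial:
  "(norm (\<Sum>k<N. b k *\<^sub>C monomial (int k)))\<^sup>2 = (\<Sum>k<N. (cmod (b k))\<^sup>2)"
proof -
  have "(\<Sum>k<N. b k *\<^sub>C monomial (int k)) = (\<Sum>n\<in>int ` {..<N}. b (nat n) *\<^sub>C monomial n)"
    by (subst sum.reindex) auto
  moreover have "(\<Sum>k<N. (cmod (b k))\<^sup>2) = (\<Sum>n\<in>int ` {..<N}. (cmod (b (nat n)))\<^sup>2)"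
    by (subst sum.reindex) auto
  ultimately show ?thesis by (simp add: norm_sum_monomial)
qed

lemma parseval_analytic:
  assumes "(\<lambda>N. \<Sum>k<N. b k *\<^sub>C monomial (int k)) \<longlonglongrightarrow> g"
  shows "(\<lambda>k. (cmod (b k))\<^sup>2) sums (norm g)\<^sup>2"
  using tendsto_power[OF tendsto_norm[OF assms], of 2]
  unfolding norm_nat_sum_monomial sums_def .

lemma fourier_coeff_analytic:
  assumes "(\<lambda>N. \<Sum>k<N. b k *\<^sub>C monomial (int k)) \<longlonglongrightarrow> g" "n < 0"
  shows "fourier_coeff g n = 0"
proof -
  have "fourier_coeff (\<Sum>k<N. b k *\<^sub>C monomial (int k)) n = 0" for N
    using \<open>n < 0\<close> by (auto simp: fourier_coeff_linear fourier_coeff_monomial intro!: sum.neutral)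
  then have "(\<lambda>N::nat. 0) \<longlonglongrightarrow> fourier_coeff g n"
    using tendsto_cinner[OF assms(1), of "monomial n"] by (simp add: fourier_coeff_def)
  then show ?thesis by (simp add: LIMSEQ_const_iff)
qed

lemma analytic_partial_sums_converge:
  assumes "\<And>n. n < 0 \<Longrightarrow> fourier_coeff f n = 0"
  shows "(\<lambda>N. \<Sum>k<N. fourier_coeff f (int k) *\<^sub>C monomial (int k)) \<longlonglongrightarrow> f"
proof -
  have "fourier_partial {- int N..int N} f
      = (\<Sum>k<Suc N. fourier_coeff f (int k) *\<^sub>C monomial (int k))" for N
  proof -
    have "fourier_partial {- int N..int N} f
        = (\<Sum>n\<in>int ` {..<Suc N}. fourier_coeff f n *\<^sub>C monomial n)"
      unfolding fourier_partial_def
    proof (rule sum.mono_neutral_right)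
      show "\<forall>i\<in>{- int N..int N} - int ` {..<Suc N}. fourier_coeff f i *\<^sub>C monomial i = 0"
      proof
        fix i assume i: "i \<in> {- int N..int N} - int ` {..<Suc N}"
        have "i < 0"
        proof (rule ccontr)
          assume "\<not> i < 0"
          then have "i = int (nat i)" "nat i < Suc N" using i by auto
          then show False using i by blast
        qed
        then show "fourier_coeff f i *\<^sub>C monomial i = 0" by (simp add: assms)
      qed
    qed auto
    also have "\<dots> = (\<Sum>k<Suc N. fourier_coeff f (int k) *\<^sub>C monomial (int k))"
      by (subst sum.reindex) auto
    finally show ?thesis .
  qed
  with fourier_series_converges[of f]
  have "(\<lambda>N. \<Sum>k<Suc N. fourier_coeff f (int k) *\<^sub>C monomial (int k)) \<longlonglongrightarrow> f"
    by simp
  then show ?thesis by (rule LIMSEQ_imp_Suc)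
qed

lemma class_of_polynomial:
  "square_integrable (\<lambda>z. \<Sum>k<N. b k * z ^ k) \<and>
   abs_l2_circle (\<lambda>z. \<Sum>k<N. b k * z ^ k) = (\<Sum>k<N. b k *\<^sub>C monomial (int k))"
proof (induction N)
  case 0
  then show ?case by (simp add: zero_l2_circle_def)
next
  case (Suc N)
  have "square_integrable (\<lambda>z. b N * z powi int N)"
    by (intro square_integrable_scale square_integrable_powi)
  moreover have "b N *\<^sub>C monomial (int N) = abs_l2_circle (\<lambda>z. b N * z powi int N)"
    by (simp only: monomial_def scaleC_class square_integrable_powi)
  ultimately show ?case
    using Suc plus_class[of "\<lambda>z. \<Sum>k<N. b k * z ^ k" "\<lambda>z. b N * z ^ N"]
    by (simp add: square_integrable_add)
qed

text \<open>The bound by \<open>\<Sum>k. cmod (b k)\<close> on the circle dominates all partial sums at once.\<close>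

lemma class_of_power_series:
  fixes b :: "nat \<Rightarrow> complex"
  assumes "summable (\<lambda>k. cmod (b k))"
  shows "square_integrable (\<lambda>z. \<Sum>k. b k * z ^ k)"
    and "(\<lambda>N. \<Sum>k<N. b k *\<^sub>C monomial (int k)) \<longlonglongrightarrow> abs_l2_circle (\<lambda>z. \<Sum>k. b k * z ^ k)"
proof -
  have ident: "(\<lambda>z::complex. z) \<in> borel_measurable circle_measure"
    by (intro borel_measurable_circle) simp
  have "(\<lambda>z. \<Sum>k<N. b k * z ^ k) \<in> borel_measurable circle_measure" for N
    using class_of_polynomial[of b N] by (simp add: square_integrable_def)
  moreover have "(\<lambda>z. \<Sum>k. b k * z ^ k) \<in> borel_measurable circle_measure"
    using ident by measurable
  moreover have "integrable circle_measure (\<lambda>z. (\<Sum>k. cmod (b k))\<^sup>2)"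
    by simp
  moreover have "AE z in circle_measure. (\<lambda>N. \<Sum>k<N. b k * z ^ k) \<longlonglongrightarrow> (\<Sum>k. b k * z ^ k)"
    using AE_circle
  proof eventually_elim
    case (elim z)
    have "summable (\<lambda>k. b k * z ^ k)"
      by (rule summable_norm_cancel) (use assms elim in \<open>simp add: norm_mult norm_power\<close>)
    then show ?case by (rule summable_LIMSEQ)
  qed
  moreover have "AE z in circle_measure. cmod (\<Sum>k<N. b k * z ^ k) \<le> (\<Sum>k. cmod (b k))" for N
    using AE_circle
  proof eventually_elim
    case (elim z)
    have "cmod (\<Sum>k<N. b k * z ^ k) \<le> (\<Sum>k<N. cmod (b k))"
      by (rule order_trans[OF norm_sum]) (simp add: norm_mult norm_power elim)
    also have "\<dots> \<le> (\<Sum>k. cmod (b k))"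
      by (rule sum_le_suminf[OF assms]) auto
    finally show ?case .
  qed
  ultimately show "square_integrable (\<lambda>z. \<Sum>k. b k * z ^ k)"
    "(\<lambda>N. \<Sum>k<N. b k *\<^sub>C monomial (int k)) \<longlonglongrightarrow> abs_l2_circle (\<lambda>z. \<Sum>k. b k * z ^ k)"
    using l2_dominated_convergence[of "\<lambda>N z. \<Sum>k<N. b k * z ^ k" "\<lambda>z. \<Sum>k. b k * z ^ k"
        "\<lambda>_. \<Sum>k. cmod (b k)"] class_of_polynomial[of b]
    by auto
qed

lemma dilation_series:
  assumes sums: "\<And>w. cmod w < 1 \<Longrightarrow> (\<lambda>k. a k * w ^ k) sums F w" and r: "0 \<le> r" "r < 1"
  shows "square_integrable (\<lambda>z. F (of_real r * z))"
    and "(\<lambda>N. \<Sum>k<N. (a k * of_real r ^ k) *\<^sub>C monomial (int k))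
           \<longlonglongrightarrow> abs_l2_circle (\<lambda>z. F (of_real r * z))"
proof -
  define b where "b = (\<lambda>k. a k * of_real r ^ k)"
  \<comment> \<open>Convergence at a point between \<open>r\<close> and 1 gives absolute convergence at \<open>r\<close>.\<close>
  obtain s where s: "r < s" "s < 1" using dense[OF r(2)] by blast
  have "summable (\<lambda>k. a k * of_real s ^ k)"
    using sums[of "of_real s"] s r by (auto simp: sums_iff)
  then have sb: "summable (\<lambda>k. cmod (b k))"
    unfolding b_def by (rule powser_insidea) (use r s in auto)
  have eq: "AE z in circle_measure. (\<Sum>k. b k * z ^ k) = F (of_real r * z)"
    using AE_circle
  proof eventually_elim
    case (elim z)
    have "(\<lambda>k. a k * (of_real r * z) ^ k) sums F (of_real r * z)"
      by (rule sums) (use elim r in \<open>simp add: norm_mult\<close>)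
    then show ?case by (simp add: b_def power_mult_distrib mult.assoc sums_iff)
  qed
  note ps = class_of_power_series[OF sb]
  show "square_integrable (\<lambda>z. F (of_real r * z))"
    using square_integrable_AE[OF ps(1) eq] .
  show "(\<lambda>N. \<Sum>k<N. (a k * of_real r ^ k) *\<^sub>C monomial (int k))
           \<longlonglongrightarrow> abs_l2_circle (\<lambda>z. F (of_real r * z))"
    using ps(2)[unfolded abs_l2_circle_eqI[OF ps(1) eq]] unfolding b_def .
qed

lemma dilation_holomorphic:
  assumes "F holomorphic_on ball 0 1" "0 \<le> r" "r < 1"
  shows "square_integrable (\<lambda>z. F (of_real r * z))"
    and "n < 0 \<Longrightarrow> fourier_coeff (abs_l2_circle (\<lambda>z. F (of_real r * z))) n = 0"
proof -
  have "(\<lambda>k. ((deriv ^^ k) F 0 / fact k) * w ^ k) sums F w" if "cmod w < 1" for w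
    using holomorphic_power_series[OF assms(1), of w] that by simp
  note series = dilation_series[OF this assms(2,3)]
  show "square_integrable (\<lambda>z. F (of_real r * z))"
    by (rule series(1))
  show "fourier_coeff (abs_l2_circle (\<lambda>z. F (of_real r * z))) n = 0" if "n < 0"
    using series(2) that by (rule fourier_coeff_analytic)
qed

lemma eventually_at_left_1: "\<forall>\<^sub>F r in at_left (1::real). 0 \<le> r \<and> r < 1"
  by (rule eventually_at_leftI[of 0]) auto

lemma has_boundary_function_iff:
  assumes "\<And>r. 0 \<le> r \<Longrightarrow> r < 1 \<Longrightarrow> square_integrable (\<lambda>z. F (of_real r * z))"
  shows "has_boundary_function F f
    \<longleftrightarrow> ((\<lambda>r. (norm (abs_l2_circle (\<lambda>z. F (of_real r * z)) - f))\<^sup>2) \<longlongrightarrow> 0) (at_left 1)"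
proof -
  obtain h where h: "square_integrable h" "f = abs_l2_circle h" by (rule l2_circle_cases)
  have "\<forall>\<^sub>F r in at_left 1. (\<integral>z. (cmod (F (of_real r * z) - h z))\<^sup>2 \<partial>circle_measure)
      = (norm (abs_l2_circle (\<lambda>z. F (of_real r * z)) - f))\<^sup>2"
    using eventually_at_left_1
    by eventually_elim (use assms h in \<open>simp add: diff_class norm_class square_integrable_diff\<close>)
  then show ?thesis
    unfolding h(2) using h(1) by (simp add: has_boundary_function.abs_eq tendsto_cong)
qed

text \<open>A dilation of a function holomorphic in the disk has a uniformly convergent Taylor series on the
  circle, so its negative Fourier coefficients vanish; coefficients are continuous in mean square,
  hence those of the boundary function vanish too. Conversely, the nonnegative coefficients \<open>a k\<close>
  of \<open>f\<close> are bounded and so define a holomorphic function \<open>F\<close> in the disk. By Parseval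
  the squared distance of its dilation by \<open>r\<close> to \<open>f\<close> is
  \<open>\<Sum>k. (cmod (a k * (r ^ k - 1)))\<^sup>2\<close>, a series dominated termwise by
  \<open>\<Sum>k. (cmod (a k))\<^sup>2\<close>; Tannery's theorem lets \<open>r\<close> tend to 1 in each term.\<close>

theorem mem_H2_iff: "f \<in> H2 \<longleftrightarrow> (\<forall>n<0. fourier_coeff f n = 0)"
proof
  assume "f \<in> H2"
  then obtain F where F: "F holomorphic_on ball 0 1" and bd: "has_boundary_function F f"
    by (auto simp: H2_def hardy_disk_def)
  note dil = dilation_holomorphic[OF F]
  show "\<forall>n<0. fourier_coeff f n = 0"
  proof (intro allI impI)
    fix n :: int assume n: "n < 0"
    let ?D = "\<lambda>r. abs_l2_circle (\<lambda>z. F (of_real r * z))"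
    have "((\<lambda>r. (norm (?D r - f))\<^sup>2) \<longlongrightarrow> 0) (at_left 1)"
      using bd has_boundary_function_iff[OF dil(1)] by simp
    from tendsto_real_sqrt[OF this] have "(?D \<longlongrightarrow> f) (at_left 1)"
      by (simp add: LIM_zero_iff tendsto_norm_zero_iff)
    then have "((\<lambda>r. fourier_coeff (?D r) n) \<longlongrightarrow> fourier_coeff f n) (at_left 1)"
      unfolding fourier_coeff_def by (rule tendsto_cinner)
    moreover have "((\<lambda>r. fourier_coeff (?D r) n) \<longlongrightarrow> 0) (at_left 1)"
      by (rule tendsto_eventually) (use eventually_at_left_1 n dil(2) in \<open>auto elim: eventually_mono\<close>)
    ultimately show "fourier_coeff f n = 0"
      using tendsto_unique trivial_limit_at_left_real by blast
  qed
next
  assume neg: "\<forall>n<0. fourier_coeff f n = 0"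
  define a where "a = (\<lambda>k. fourier_coeff f (int k))"
  define F where "F = (\<lambda>w. \<Sum>k. a k * w ^ k)"
  have F: "(\<lambda>k. a k * w ^ k) sums F w" if "cmod w < 1" for w
  proof -
    have "summable (\<lambda>k. norm f * cmod w ^ k)"
      using that by (intro summable_mult summable_geometric) simp
    then have "summable (\<lambda>k. a k * w ^ k)"
      by (rule summable_comparison_test') 
        (auto simp: a_def norm_mult norm_power intro!: mult_right_mono norm_fourier_coeff_le)
    then show ?thesis unfolding F_def by (rule summable_sums)
  qed
  have hol: "F holomorphic_on ball 0 1"
    by (rule power_series_holomorphic[of 0 1 a]) (use F in simp)
  have f: "(\<lambda>N. \<Sum>k<N. a k *\<^sub>C monomial (int k)) \<longlonglongrightarrow> f"
    unfolding a_def by (rule analytic_partial_sums_converge) (use neg in simp)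
  note Parseval = parseval_analytic[OF f]
  let ?D = "\<lambda>r. abs_l2_circle (\<lambda>z. F (of_real r * z))"
  have norm_D: "(\<lambda>k. (cmod (a k * of_real r ^ k))\<^sup>2) sums (norm (?D r))\<^sup>2" if "0 \<le> r" "r < 1" for r
    by (rule parseval_analytic[OF dilation_series(2)[OF F that]])
  have norm_diff: "(\<lambda>k. (cmod (a k * (of_real r ^ k - 1)))\<^sup>2) sums (norm (?D r - f))\<^sup>2"
    if "0 \<le> r" "r < 1" for r
  proof (rule parseval_analytic)
    show "(\<lambda>N. \<Sum>k<N. (a k * (of_real r ^ k - 1)) *\<^sub>C monomial (int k)) \<longlonglongrightarrow> ?D r - f"
      using tendsto_diff[OF dilation_series(2)[OF F that] f]
      by (simp add: sum_subtractf[symmetric] scaleC_diff_left[symmetric] right_diff_distrib)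
  qed
  have shrink: "0 \<le> 1 - r ^ k \<and> 1 - r ^ k \<le> 1" if "0 \<le> r" "r < 1" for r :: real and k
    using that by (simp add: power_le_one)
  have "F \<in> hardy_disk"
    unfolding hardy_disk_def
  proof (intro CollectI conjI hol exI ballI)
    fix r :: real assume "r \<in> {0..<1}"
    then have r: "0 \<le> r" "r < 1" by auto
    have "(cmod (a k * of_real r ^ k))\<^sup>2 \<le> (cmod (a k))\<^sup>2" for k
      using r by (intro power_mono) (auto simp: norm_mult norm_power power_le_one mult_left_le)
    then have "(norm (?D r))\<^sup>2 \<le> (norm f)\<^sup>2"
      by (rule sums_le[OF _ norm_D[OF r] Parseval])
    then show "(\<integral>z. (cmod (F (of_real r * z)))\<^sup>2 \<partial>circle_measure) \<le> (norm f)\<^sup>2"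
      using norm_class[OF dilation_series(1)[OF F r]] by simp
  qed
  moreover have "has_boundary_function F f"
  proof -
    have "((\<lambda>r. \<Sum>k. (cmod (a k * (of_real r ^ k - 1)))\<^sup>2) \<longlongrightarrow> (\<Sum>k::nat. 0)) (at_left 1)"
    proof (rule tannerys_theorem[THEN conjunct2, THEN conjunct2])
      show "summable (\<lambda>k. (cmod (a k))\<^sup>2)" using Parseval by (simp add: sums_iff)
      fix k
      have "((\<lambda>r. (cmod (a k * (of_real r ^ k - 1)))\<^sup>2)
          \<longlongrightarrow> (cmod (a k * (of_real 1 ^ k - 1)))\<^sup>2) (at_left 1)"
        by (intro tendsto_intros)
      then show "((\<lambda>r. (cmod (a k * (of_real r ^ k - 1)))\<^sup>2) \<longlongrightarrow> 0) (at_left 1)" by simp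
    next
      have "\<forall>\<^sub>F x in sequentially \<times>\<^sub>F at_left (1::real). True \<and> (0 \<le> snd x \<and> snd x < 1)"
        by (rule eventually_prodI[OF _ eventually_at_left_1]) simp
      then show "\<forall>\<^sub>F (k, r) in sequentially \<times>\<^sub>F at_left 1.
          norm ((cmod (a k * (of_real r ^ k - 1)))\<^sup>2) \<le> (cmod (a k))\<^sup>2"
      proof eventually_elim
        case (elim x)
        obtain k r where x: "x = (k, r)" by (cases x)
        have "cmod (of_real r ^ k - 1) = 1 - r ^ k"
          using shrink[of r k] elim x
          by (metis abs_minus_commute abs_of_nonneg norm_of_real of_real_1 of_real_diff of_real_power snd_conv)
        then have "cmod (a k * (of_real r ^ k - 1)) \<le> cmod (a k)"
          using shrink[of r k] elim x by (simp add: norm_mult mult_left_le)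
        then show ?case using x by (auto intro!: power_mono)
      qed
    qed simp
    moreover have "\<forall>\<^sub>F r in at_left 1.
        (\<Sum>k. (cmod (a k * (of_real r ^ k - 1)))\<^sup>2) = (norm (?D r - f))\<^sup>2"
      using eventually_at_left_1 by eventually_elim (use norm_diff in \<open>auto simp: sums_iff\<close>)
    ultimately have "((\<lambda>r. (norm (?D r - f))\<^sup>2) \<longlongrightarrow> 0) (at_left 1)"
      by (simp add: tendsto_cong)
    then show ?thesis
      by (subst has_boundary_function_iff) (rule dilation_series(1)[OF F])
  qed
  ultimately show "f \<in> H2" by (auto simp: H2_def)
qed

lemma radial_limit_tendsto:
  assumes "inner_function \<theta>"
  shows "AE z in circle_measure.
    ((\<lambda>r. \<theta> (of_real r * z)) \<longlongrightarrow> radial_limit \<theta> z) (at_left 1) \<and> cmod (radial_limit \<theta> z) = 1"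
proof -
  have "AE z in circle_measure. \<exists>l. ((\<lambda>r. \<theta> (of_real r * z)) \<longlongrightarrow> l) (at_left (1::real)) \<and> cmod l = 1"
    using assms by (simp add: inner_function_def)
  then show ?thesis
  proof eventually_elim
    case (elim z)
    then obtain l where l: "((\<lambda>r. \<theta> (of_real r * z)) \<longlongrightarrow> l) (at_left (1::real))" "cmod l = 1"
      by blast
    then have "radial_limit \<theta> z = l"
      unfolding radial_limit_def by (intro tendsto_Lim) auto
    then show ?case using l by simp
  qed
qed

text \<open>Along a sequence of radii increasing to 1 the dilations of \<open>\<theta>\<close> converge almost everywhere to
  the radial limit, which makes it measurable. They are uniformly bounded, so they also converge in
  mean square, and their vanishing negative Fourier coefficients pass to the limit.\<close>

lemma inner_function_boundary:
  assumes inner: "inner_function \<theta>"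
  shows "radial_limit \<theta> \<in> borel_measurable circle_measure"
    and "AE z in circle_measure. cmod (radial_limit \<theta> z) = 1"
    and "abs_l2_circle (radial_limit \<theta>) \<in> H2"
proof -
  have hol: "\<theta> holomorphic_on ball 0 1" using inner by (simp add: inner_function_def)
  from inner obtain B where B: "\<And>w. w \<in> ball 0 1 \<Longrightarrow> cmod (\<theta> w) \<le> B"
    unfolding inner_function_def bounded_iff by blast
  define r where "r = (\<lambda>n::nat. 1 - 1 / real (Suc n))"
  have r: "0 \<le> r n" "r n < 1" for n by (auto simp: r_def)
  have "r \<longlonglongrightarrow> 1 - 0"
    unfolding r_def by (intro tendsto_diff tendsto_const LIMSEQ_Suc lim_1_over_n)
  then have r_lim: "filterlim r (at_left 1) sequentially"
    using r by (auto simp: filterlim_at less_imp_neq)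
  note dil = dilation_holomorphic[OF hol r]
  show unimod: "AE z in circle_measure. cmod (radial_limit \<theta> z) = 1"
    using radial_limit_tendsto[OF inner] by eventually_elim simp
  have lim: "AE z in circle_measure. (\<lambda>n. \<theta> (of_real (r n) * z)) \<longlonglongrightarrow> radial_limit \<theta> z"
    using radial_limit_tendsto[OF inner]
    by eventually_elim (use filterlim_compose[OF _ r_lim] in blast)
  have meas: "(\<lambda>z. \<theta> (of_real (r n) * z)) \<in> borel_measurable circle_measure" for n
    using dil(1) by (simp add: square_integrable_def)
  have "(\<lambda>z. lim (\<lambda>n. \<theta> (of_real (r n) * z))) \<in> borel_measurable circle_measure"
    using meas by (rule borel_measurable_lim_metric)
  then show rl: "radial_limit \<theta> \<in> borel_measurable circle_measure"
    by (rule circle_measurable_AE) (use lim in \<open>eventually_elim, simp add: limI\<close>)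
  have bound: "AE z in circle_measure. cmod (\<theta> (of_real (r n) * z)) \<le> B" for n
    using AE_circle
  proof eventually_elim
    case (elim z)
    show ?case by (rule B) (use elim r[of n] in \<open>simp add: norm_mult\<close>)
  qed
  have conv: "(\<lambda>n. abs_l2_circle (\<lambda>z. \<theta> (of_real (r n) * z))) \<longlonglongrightarrow> abs_l2_circle (radial_limit \<theta>)"
    by (rule l2_dominated_convergence(2)[OF meas rl _ lim bound]) simp
  show "abs_l2_circle (radial_limit \<theta>) \<in> H2"
    unfolding mem_H2_iff
  proof (intro allI impI)
    fix n :: int assume "n < 0"
    then have "(\<lambda>_::nat. 0) \<longlonglongrightarrow> fourier_coeff (abs_l2_circle (radial_limit \<theta>)) n"
      using tendsto_cinner[OF conv, of "monomial n"] dil(2) by (simp add: fourier_coeff_def)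
    then show "fourier_coeff (abs_l2_circle (radial_limit \<theta>)) n = 0"
      by (simp add: LIMSEQ_const_iff)
  qed
qed



section \<open>Multiplication by unimodular functions\<close>

definition unimodular :: "(complex \<Rightarrow> complex) \<Rightarrow> bool" where
  "unimodular u \<longleftrightarrow> u \<in> borel_measurable circle_measure \<and> (AE z in circle_measure. cmod (u z) = 1)"

lemma unimodular_id [simp]: "unimodular (\<lambda>z. z)"
  using AE_circle by (simp add: unimodular_def borel_measurable_circle)

lemma unimodular_cnj:
  assumes "unimodular u"
  shows "unimodular (\<lambda>z. cnj (u z))"
proof -
  have "square_integrable u"
    by (rule square_integrable_bounded[of _ 1])
      (use assms in \<open>auto simp: unimodular_def elim: eventually_mono\<close>)
  from square_integrable_cnj[OF this] show ?thesis
    using assms by (simp add: unimodular_def square_integrable_def)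
qed

lemma unimodular_mult:
  assumes "unimodular u" "unimodular v"
  shows "unimodular (\<lambda>z. u z * v z)"
  using assms by (auto simp: unimodular_def norm_mult)

lemma square_integrable_unimodular_mult:
  assumes "unimodular u" "square_integrable f"
  shows "square_integrable (\<lambda>z. u z * f z)"
  by (rule square_integrable_bounded_mult[of u 1]) (use assms in \<open>auto simp: unimodular_def\<close>)

lemma mult_by_unimodular_class:
  assumes "unimodular u" "square_integrable f"
  shows "mult_by u (abs_l2_circle f) = abs_l2_circle (\<lambda>z. u z * f z)"
  by (intro mult_by_class assms square_integrable_unimodular_mult)

lemma mult_by_add:
  assumes "unimodular u"
  shows "mult_by u (f + g) = mult_by u f + mult_by u g"
proof -
  obtain f' where f: "square_integrable f'" "f = abs_l2_circle f'" by (rule l2_circle_cases)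
  obtain g' where g: "square_integrable g'" "g = abs_l2_circle g'" by (rule l2_circle_cases)
  show ?thesis
    by (simp add: f g plus_class mult_by_unimodular_class assms square_integrable_add
        square_integrable_unimodular_mult distrib_left)
qed

lemma mult_by_scaleC:
  assumes "unimodular u"
  shows "mult_by u (c *\<^sub>C f) = c *\<^sub>C mult_by u f"
proof -
  obtain f' where f: "square_integrable f'" "f = abs_l2_circle f'" by (rule l2_circle_cases)
  show ?thesis
    by (simp add: f scaleC_class mult_by_unimodular_class assms square_integrable_scale
        square_integrable_unimodular_mult mult.left_commute)
qed

lemma mult_by_diff:
  assumes "unimodular u"
  shows "mult_by u (f - g) = mult_by u f - mult_by u g"
  by (metis add_diff_cancel_right' assms diff_add_cancel mult_by_add)

lemma mult_by_mult_by:
  assumes "unimodular u" "unimodular v"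
  shows "mult_by u (mult_by v f) = mult_by (\<lambda>z. u z * v z) f"
proof -
  obtain f' where f: "square_integrable f'" "f = abs_l2_circle f'" by (rule l2_circle_cases)
  show ?thesis
    by (simp add: f mult_by_unimodular_class assms unimodular_mult
        square_integrable_unimodular_mult mult.assoc)
qed

text \<open>Multiplication by a unimodular function is unitary, its inverse being multiplication by the
  conjugate.\<close>

lemma mult_by_cnj_cancel:
  assumes "unimodular u"
  shows "mult_by u (mult_by (\<lambda>z. cnj (u z)) f) = f" "mult_by (\<lambda>z. cnj (u z)) (mult_by u f) = f"
proof -
  obtain f' where f: "square_integrable f'" "f = abs_l2_circle f'" by (rule l2_circle_cases)
  have "AE z in circle_measure. cmod (u z) = 1"
    using assms by (simp add: unimodular_def)
  then have eq: "AE z in circle_measure. u z * cnj (u z) * f' z = f' z"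
  proof eventually_elim
    case (elim z)
    then show ?case by (simp only: complex_norm_square[symmetric]) simp
  qed
  have "square_integrable (\<lambda>z. u z * cnj (u z) * f' z)"
    by (intro square_integrable_unimodular_mult unimodular_mult unimodular_cnj assms f)
  from abs_l2_circle_eqI[OF this eq]
  show 1: "mult_by u (mult_by (\<lambda>z. cnj (u z)) f) = f"
    by (simp add: f mult_by_unimodular_class assms unimodular_cnj square_integrable_unimodular_mult
        mult.assoc)
  have "mult_by (\<lambda>z. cnj (u z)) (mult_by u f) = mult_by u (mult_by (\<lambda>z. cnj (u z)) f)"
    by (simp add: mult_by_mult_by assms unimodular_cnj mult.commute)
  with 1 show "mult_by (\<lambda>z. cnj (u z)) (mult_by u f) = f" by simp
qed

lemma cinner_mult_by:
  assumes "unimodular u"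
  shows "cinner (mult_by u f) g = cinner f (mult_by (\<lambda>z. cnj (u z)) g)"
proof -
  obtain f' where f: "square_integrable f'" "f = abs_l2_circle f'" by (rule l2_circle_cases)
  obtain g' where g: "square_integrable g'" "g = abs_l2_circle g'" by (rule l2_circle_cases)
  have "cinner (mult_by u f) g = (\<integral>z. u z * f' z * cnj (g' z) \<partial>circle_measure)"
    by (simp add: f g cinner_class mult_by_unimodular_class assms square_integrable_unimodular_mult)
  also have "\<dots> = (\<integral>z. f' z * cnj (cnj (u z) * g' z) \<partial>circle_measure)"
    by (simp add: mult_ac)
  also have "\<dots> = cinner f (mult_by (\<lambda>z. cnj (u z)) g)"
    unfolding f(2) g(2) mult_by_unimodular_class[OF unimodular_cnj[OF assms] g(1)]
    by (intro cinner_class[symmetric] f(1) square_integrable_unimodular_mult unimodular_cnj assms g(1))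
  finally show ?thesis .
qed

lemma cinner_mult_by_isometry:
  assumes "unimodular u"
  shows "cinner (mult_by u f) (mult_by u g) = cinner f g"
  by (simp add: cinner_mult_by mult_by_cnj_cancel assms)

lemma cnj_l2_mult_by:
  assumes "unimodular u"
  shows "cnj_l2 (mult_by u f) = mult_by (\<lambda>z. cnj (u z)) (cnj_l2 f)"
proof -
  obtain f' where f: "square_integrable f'" "f = abs_l2_circle f'" by (rule l2_circle_cases)
  show ?thesis
    by (simp add: f cnj_l2_class mult_by_unimodular_class assms unimodular_cnj
        square_integrable_cnj square_integrable_unimodular_mult)
qed

lemma cnj_l2_add: "cnj_l2 (f + g) = cnj_l2 f + cnj_l2 g"
proof -
  obtain f' where f: "square_integrable f'" "f = abs_l2_circle f'" by (rule l2_circle_cases)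
  obtain g' where g: "square_integrable g'" "g = abs_l2_circle g'" by (rule l2_circle_cases)
  show ?thesis
    by (simp add: f g cnj_l2_class plus_class square_integrable_cnj square_integrable_add)
qed

lemma cnj_l2_scaleC: "cnj_l2 (c *\<^sub>C f) = cnj c *\<^sub>C cnj_l2 f"
proof -
  obtain f' where f: "square_integrable f'" "f = abs_l2_circle f'" by (rule l2_circle_cases)
  show ?thesis
    by (simp add: f cnj_l2_class scaleC_class square_integrable_cnj square_integrable_scale)
qed

lemma cnj_l2_cnj_l2 [simp]: "cnj_l2 (cnj_l2 f) = f"
proof -
  obtain f' where f: "square_integrable f'" "f = abs_l2_circle f'" by (rule l2_circle_cases)
  show ?thesis by (simp add: f cnj_l2_class square_integrable_cnj)
qed

lemma cinner_cnj_l2: "cinner (cnj_l2 f) g = cinner (cnj_l2 g) f"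
proof -
  obtain f' where f: "square_integrable f'" "f = abs_l2_circle f'" by (rule l2_circle_cases)
  obtain g' where g: "square_integrable g'" "g = abs_l2_circle g'" by (rule l2_circle_cases)
  show ?thesis by (simp add: f g cnj_l2_class cinner_class square_integrable_cnj mult.commute)
qed

lemma cnj_l2_monomial: "cnj_l2 (monomial n) = monomial (- n)"
proof -
  have "AE z in circle_measure. cnj (z powi n) = z powi (- n)"
    using AE_circle by eventually_elim (rule cnj_powi_circle)
  then show ?thesis
    unfolding monomial_def cnj_l2_class[OF square_integrable_powi]
    by (intro abs_l2_circle_eqI square_integrable_cnj square_integrable_powi)
qed

lemma shift_monomial: "mult_by (\<lambda>z. z) (monomial n) = monomial (n + 1)"
proof -
  have "AE z in circle_measure. z * z powi n = z powi (n + 1)"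
    using AE_circle
  proof eventually_elim
    case (elim z)
    then have "z \<noteq> 0" by auto
    then show ?case by (simp add: power_int_add)
  qed
  then show ?thesis
    unfolding monomial_def mult_by_unimodular_class[OF unimodular_id square_integrable_powi]
    by (intro abs_l2_circle_eqI square_integrable_unimodular_mult unimodular_id square_integrable_powi)
qed

lemma unshift_monomial: "mult_by cnj (monomial n) = monomial (n - 1)"
  using mult_by_cnj_cancel(2)[OF unimodular_id, of "monomial (n - 1)"] by (simp add: shift_monomial)

lemma unimodular_cnj_id [simp]: "unimodular cnj"
  using unimodular_cnj[OF unimodular_id] by simp

lemma shift_unshift [simp]:
  "mult_by (\<lambda>z. z) (mult_by cnj f) = f" "mult_by cnj (mult_by (\<lambda>z. z) f) = f"
  using mult_by_cnj_cancel[OF unimodular_id, of f] by simp_all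

lemma cinner_shift: "cinner (mult_by (\<lambda>z. z) f) g = cinner f (mult_by cnj g)"
  and cinner_unshift: "cinner (mult_by cnj f) g = cinner f (mult_by (\<lambda>z. z) g)"
  using cinner_mult_by[OF unimodular_id, of f g] cinner_mult_by[OF unimodular_cnj_id, of f g]
  by simp_all

lemma fourier_coeff_shift: "fourier_coeff (mult_by (\<lambda>z. z) f) n = fourier_coeff f (n - 1)"
  and fourier_coeff_unshift: "fourier_coeff (mult_by cnj f) n = fourier_coeff f (n + 1)"
  by (simp_all add: fourier_coeff_def cinner_shift cinner_unshift shift_monomial unshift_monomial)

lemma fourier_coeff_cnj_l2: "fourier_coeff (cnj_l2 f) n = cnj (fourier_coeff f (- n))"
  unfolding fourier_coeff_def
  by (subst cinner_cnj_l2) (simp add: cnj_l2_monomial flip: cinner_commute)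

lemma mult_by_commute:
  assumes "unimodular u" "unimodular v"
  shows "mult_by u (mult_by v f) = mult_by v (mult_by u f)"
  using assms by (simp add: mult_by_mult_by mult.commute)


section \<open>The model space\<close>

lemma H2_closed:
  "f \<in> H2 \<Longrightarrow> g \<in> H2 \<Longrightarrow> f + g \<in> H2"
  "f \<in> H2 \<Longrightarrow> g \<in> H2 \<Longrightarrow> f - g \<in> H2"
  "f \<in> H2 \<Longrightarrow> c *\<^sub>C f \<in> H2"
  "f \<in> H2 \<Longrightarrow> mult_by (\<lambda>z. z) f \<in> H2"
  by (auto simp: mem_H2_iff fourier_coeff_linear fourier_coeff_shift)

lemma monomial_in_H2: "0 \<le> n \<Longrightarrow> monomial n \<in> H2"
  by (simp add: mem_H2_iff fourier_coeff_monomial)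

text \<open>If \<open>f\<close> is the boundary function of \<open>F\<close>, this is the boundary function of
  \<open>(F(w) - F(0)) / w\<close>. The zeroth Fourier coefficient plays the role of the value at the origin
  throughout.\<close>

definition backward_shift :: "l2_circle \<Rightarrow> l2_circle" where
  "backward_shift f = mult_by cnj (f - fourier_coeff f 0 *\<^sub>C monomial 0)"

lemma fourier_coeff_backward_shift:
  "fourier_coeff (backward_shift f) n = (if n = -1 then 0 else fourier_coeff f (n + 1))"
  by (auto simp: backward_shift_def fourier_coeff_unshift fourier_coeff_linear fourier_coeff_monomial)

lemma backward_shift_H2: "f \<in> H2 \<Longrightarrow> backward_shift f \<in> H2"
  by (auto simp: mem_H2_iff fourier_coeff_backward_shift)

lemma H2_decompose: "f = fourier_coeff f 0 *\<^sub>C monomial 0 + mult_by (\<lambda>z. z) (backward_shift f)"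
  by (simp add: backward_shift_def)

text \<open>The inner product is the mean over the circle of \<open>z f(z) g(z)\<close>, a product that vanishes at
  the origin. In terms of frequencies: those of \<open>z f(z)\<close> are positive and those of the conjugate
  of \<open>g\<close> are not.\<close>

lemma cinner_shift_cnj_H2:
  assumes "f \<in> H2" "g \<in> H2"
  shows "cinner (mult_by (\<lambda>z. z) f) (cnj_l2 g) = 0"
proof (rule cinner_eq_0_if_disjoint_spectra)
  fix n :: int
  show "fourier_coeff (mult_by (\<lambda>z. z) f) n = 0 \<or> fourier_coeff (cnj_l2 g) n = 0"
    using assms by (cases "n \<le> 0") (auto simp: mem_H2_iff fourier_coeff_shift fourier_coeff_cnj_l2)
qed

text \<open>Projection and adjoint are given by descriptions, so an explicit candidate settles existence as
  well as value.\<close>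

lemma orth_proj_eqI:
  assumes diff: "\<And>f g. f \<in> K \<Longrightarrow> g \<in> K \<Longrightarrow> f - g \<in> K"
    and p: "p \<in> K" "\<And>k. k \<in> K \<Longrightarrow> cinner (f - p) k = 0"
  shows "orth_proj K f = p"
  unfolding orth_proj_def
proof (rule the_equality)
  fix q assume q: "q \<in> K \<and> (\<forall>k\<in>K. cinner (f - q) k = 0)"
  have d: "q - p \<in> K" using diff q p by blast
  have "cinner (q - p) (q - p) = cinner (f - p) (q - p) - cinner (f - q) (q - p)"
    by (simp flip: cinner_diff_left)
  also have "\<dots> = 0" using q p d by simp
  finally show "q = p" by (simp add: cinner_norm)
qed (use p in auto)

lemma adjoint_on_eqI:
  assumes diff: "\<And>f g. f \<in> K \<Longrightarrow> g \<in> K \<Longrightarrow> f - g \<in> K"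
    and h: "h \<in> K" "\<And>f. f \<in> K \<Longrightarrow> cinner (T f) g = cinner f h"
  shows "adjoint_on K T g = h"
  unfolding adjoint_on_def
proof (rule the_equality)
  fix k assume k: "k \<in> K \<and> (\<forall>f\<in>K. cinner (T f) g = cinner f k)"
  have "cinner (k - h) (k - h) = cinner (k - h) k - cinner (k - h) h"
    by (rule cinner_diff_right)
  also have "\<dots> = 0" using k h diff[of k h] by (metis diff_self)
  finally show "k = h" by (simp add: cinner_norm)
qed (use h in auto)

locale inner_multiplier =
  fixes \<theta> :: "complex \<Rightarrow> complex"
  assumes inner: "inner_function \<theta>"
begin

abbreviation K where "K \<equiv> model_space \<theta>"
abbreviation T where "T \<equiv> mult_by (radial_limit \<theta>)"
abbreviation S where "S \<equiv> compressed_shift \<theta>"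
abbreviation C where "C \<equiv> model_conjugation \<theta>"
abbreviation e where "e \<equiv> T (monomial 0)"

lemma unimodular_boundary: "unimodular (radial_limit \<theta>)"
  using inner_function_boundary[OF inner] by (simp add: unimodular_def)

lemma e_in_H2: "e \<in> H2"
proof -
  have "e = abs_l2_circle (\<lambda>z. radial_limit \<theta> z * z powi 0)"
    unfolding monomial_def
    by (rule mult_by_unimodular_class[OF unimodular_boundary square_integrable_powi])
  then show ?thesis using inner_function_boundary(3)[OF inner] by simp
qed

lemma T_shift: "T (mult_by (\<lambda>z. z) f) = mult_by (\<lambda>z. z) (T f)"
  and T_unshift: "T (mult_by cnj f) = mult_by cnj (T f)"
  by (intro mult_by_commute unimodular_boundary unimodular_id unimodular_cnj_id)+

lemma model_space_iff: "f \<in> K \<longleftrightarrow> f \<in> H2 \<and> (\<forall>g\<in>H2. cinner f (T g) = 0)"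
  by (simp add: model_space_def)

lemma K_subset_H2: "f \<in> K \<Longrightarrow> f \<in> H2"
  by (simp add: model_space_iff)

lemma K_closed:
  "f \<in> K \<Longrightarrow> g \<in> K \<Longrightarrow> f + g \<in> K"
  "f \<in> K \<Longrightarrow> g \<in> K \<Longrightarrow> f - g \<in> K"
  "f \<in> K \<Longrightarrow> c *\<^sub>C f \<in> K"
  by (auto simp: model_space_iff H2_closed cinner_add_left cinner_diff_left cinner_scaleC_left)

lemma cinner_e:
  assumes "f \<in> K"
  shows "cinner f e = 0" "cinner e f = 0"
proof -
  show 1: "cinner f e = 0" using assms monomial_in_H2[of 0] by (simp add: model_space_iff)
  show "cinner e f = 0" by (subst cinner_commute) (simp add: 1)
qed

text \<open>The product of \<open>\<theta>\<close> and \<open>z g(z)\<close> is holomorphic and vanishes at the origin, hence has mean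
  value 0.\<close>

lemma cinner_one_T_shift:
  assumes "g \<in> H2"
  shows "cinner (monomial 0) (T (mult_by (\<lambda>z. z) g)) = 0"
proof -
  have "cinner (T (mult_by (\<lambda>z. z) g)) (monomial 0) = cinner (mult_by (\<lambda>z. z) g) (cnj_l2 e)"
    by (simp add: cinner_mult_by cnj_l2_mult_by cnj_l2_monomial unimodular_boundary)
  also have "\<dots> = 0" using cinner_shift_cnj_H2[OF assms e_in_H2] .
  finally show ?thesis by (subst cinner_commute) simp
qed

lemma cinner_T: "cinner (T f) (T g) = cinner f g"
  by (rule cinner_mult_by_isometry[OF unimodular_boundary])

text \<open>For \<open>f\<close> in the model space, \<open>z f\<close> is orthogonal to \<open>z \<theta> H2\<close>, which has codimension one in
  \<open>\<theta> H2\<close> with complement spanned by the unit vector \<open>e\<close>, the class of \<open>\<theta>\<close>. So only the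
  component along \<open>e\<close> has to be removed.\<close>

lemma shift_projected_in_K:
  assumes f: "f \<in> K"
  shows "mult_by (\<lambda>z. z) f - cinner (mult_by (\<lambda>z. z) f) e *\<^sub>C e \<in> K"
proof -
  define c where "c = cinner (mult_by (\<lambda>z. z) f) e"
  define p where "p = mult_by (\<lambda>z. z) f - c *\<^sub>C e"
  have "cinner p (T g) = 0" if g: "g \<in> H2" for g
  proof -
    define h where "h = backward_shift g"
    have h: "h \<in> H2" using g by (simp add: h_def backward_shift_H2)
    have "T g = fourier_coeff g 0 *\<^sub>C e + T (mult_by (\<lambda>z. z) h)"
      unfolding h_def by (subst H2_decompose[of g])
        (simp only: mult_by_add mult_by_scaleC unimodular_boundary)
    moreover have "cinner p e = 0"
      by (simp add: p_def c_def cinner_diff_left cinner_scaleC_left cinner_T cinner_monomial)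
    moreover have "cinner p (T (mult_by (\<lambda>z. z) h)) = 0"
    proof -
      have "cinner e (T (mult_by (\<lambda>z. z) h)) = cnj (fourier_coeff h (-1))"
        unfolding cinner_T fourier_coeff_def
        by (subst cinner_commute) (simp add: cinner_shift unshift_monomial)
      also have "\<dots> = 0" using h by (simp add: mem_H2_iff)
      finally have "cinner e (T (mult_by (\<lambda>z. z) h)) = 0" .
      moreover have "cinner (mult_by (\<lambda>z. z) f) (T (mult_by (\<lambda>z. z) h)) = cinner f (T h)"
        by (simp add: T_shift cinner_shift)
      ultimately show ?thesis
        using f h by (simp add: p_def cinner_diff_left cinner_scaleC_left model_space_iff)
    qed
    ultimately show ?thesis by (simp add: cinner_add_right cinner_scaleC_right)
  qed
  moreover have "p \<in> H2"
    unfolding p_def by (intro H2_closed e_in_H2 K_subset_H2 f)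
  ultimately show ?thesis by (simp add: p_def c_def model_space_iff)
qed

lemma compressed_shift_eq:
  assumes f: "f \<in> K"
  shows "S f = mult_by (\<lambda>z. z) f - cinner (mult_by (\<lambda>z. z) f) e *\<^sub>C e"
  unfolding compressed_shift_def
  by (rule orth_proj_eqI[OF K_closed(2) shift_projected_in_K[OF f]])
    (simp_all add: cinner_scaleC_left cinner_e)

lemma compressed_shift_in_K: "f \<in> K \<Longrightarrow> S f \<in> K"
  by (simp add: compressed_shift_eq shift_projected_in_K)

lemma backward_shift_in_K:
  assumes f: "f \<in> K"
  shows "backward_shift f \<in> K"
  unfolding model_space_iff
proof (intro conjI ballI)
  show "backward_shift f \<in> H2" by (intro backward_shift_H2 K_subset_H2 f)
  fix g assume g: "g \<in> H2"
  have "cinner (backward_shift f) (T g)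
      = cinner (f - fourier_coeff f 0 *\<^sub>C monomial 0) (T (mult_by (\<lambda>z. z) g))"
    by (simp add: backward_shift_def cinner_unshift T_shift)
  also have "\<dots> = 0"
    using f g by (simp add: cinner_diff_left cinner_scaleC_left cinner_one_T_shift
        model_space_iff H2_closed)
  finally show "cinner (backward_shift f) (T g) = 0" .
qed

text \<open>Functions in the model space are orthogonal to \<open>e\<close>, so the correction term of the compressed
  shift drops out; subtracting the constant in the backward shift costs nothing because \<open>z f\<close> has
  mean value 0.\<close>

lemma adjoint_compressed_shift:
  assumes g: "g \<in> K"
  shows "adjoint_on K S g = backward_shift g"
proof (rule adjoint_on_eqI[OF K_closed(2) backward_shift_in_K[OF g]])
  fix f assume f: "f \<in> K"
  have "cinner (mult_by (\<lambda>z. z) f) (monomial 0) = 0"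
    using K_subset_H2[OF f] fourier_coeff_shift[of f 0] by (simp add: fourier_coeff_def mem_H2_iff)
  then show "cinner (S f) g = cinner f (backward_shift g)"
    by (simp add: compressed_shift_eq f g cinner_e backward_shift_def cinner_diff_left
        cinner_scaleC_left cinner_diff_right cinner_scaleC_right flip: cinner_shift)
qed


section \<open>The conjugation\<close>

lemma unimodular_conjugation: "unimodular (\<lambda>z. radial_limit \<theta> z * cnj z)"
  by (intro unimodular_mult unimodular_boundary unimodular_cnj_id)

lemma conjugation_eq: "C f = T (mult_by cnj (cnj_l2 f))"
  unfolding model_conjugation_def
  by (simp add: mult_by_mult_by unimodular_boundary)

lemma conjugation_linear:
  "C (f + g) = C f + C g" "C (c *\<^sub>C f) = cnj c *\<^sub>C C f"
  by (simp_all add: model_conjugation_def cnj_l2_add cnj_l2_scaleC mult_by_add mult_by_scaleC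
      unimodular_conjugation)

lemma conjugation_diff: "C (f - g) = C f - C g"
  by (metis add_diff_cancel_right' diff_add_cancel conjugation_linear(1))

lemma conjugation_involution: "C (C f) = f"
  using mult_by_cnj_cancel(1)[OF unimodular_conjugation, of f]
    cnj_l2_mult_by[OF unimodular_conjugation, of "cnj_l2 f"]
  by (simp add: model_conjugation_def)

text \<open>The antiunitary symmetry \<open>\<langle>C f, g\<rangle> = \<langle>C g, f\<rangle>\<close>, with \<open>C g\<close> written in the form in which
  it is evaluated below.\<close>

lemma cinner_conjugation: "cinner (C f) g = cinner (T (mult_by cnj (cnj_l2 g))) f"
proof -
  have "cinner (C f) g = cinner (cnj_l2 f) (mult_by (\<lambda>z. cnj (radial_limit \<theta> z * cnj z)) g)"
    unfolding model_conjugation_def by (rule cinner_mult_by[OF unimodular_conjugation])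
  also have "\<dots> = cinner (cnj_l2 (mult_by (\<lambda>z. cnj (radial_limit \<theta> z * cnj z)) g)) f"
    by (rule cinner_cnj_l2)
  also have "cnj_l2 (mult_by (\<lambda>z. cnj (radial_limit \<theta> z * cnj z)) g)
      = mult_by (\<lambda>z. radial_limit \<theta> z * cnj z) (cnj_l2 g)"
    using cnj_l2_mult_by[OF unimodular_cnj[OF unimodular_conjugation], of g] by simp
  finally show ?thesis
    by (simp add: mult_by_mult_by unimodular_boundary)
qed

text \<open>The two conditions defining the model space are exchanged by the conjugation: a negative
  coefficient of \<open>C f\<close> is the conjugate of an inner product of \<open>f\<close> with an element of \<open>\<theta> H2\<close>,
  and orthogonality of \<open>C f\<close> to \<open>\<theta> H2\<close> expresses that \<open>f\<close> has no negative frequencies.\<close>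

lemma conjugation_in_K:
  assumes f: "f \<in> K"
  shows "C f \<in> K"
  unfolding model_space_iff mem_H2_iff
proof (intro conjI ballI allI impI)
  fix n :: int assume n: "n < 0"
  have "fourier_coeff (C f) n = cinner (T (monomial (- n - 1))) f"
    by (simp add: fourier_coeff_def cinner_conjugation cnj_l2_monomial unshift_monomial)
  also have "\<dots> = cnj (cinner f (T (monomial (- n - 1))))"
    by (rule cinner_commute)
  also have "\<dots> = 0"
    using f n monomial_in_H2[of "- n - 1"] by (simp add: model_space_iff)
  finally show "fourier_coeff (C f) n = 0" .
next
  fix g assume g: "g \<in> H2"
  have "cinner (C f) (T g) = cinner (cnj_l2 f) (mult_by (\<lambda>z. z) g)"
    by (simp add: conjugation_eq cinner_T cinner_unshift)
  also have "\<dots> = cnj (cinner (mult_by (\<lambda>z. z) g) (cnj_l2 f))"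
    by (rule cinner_commute)
  also have "\<dots> = 0" using cinner_shift_cnj_H2[OF g K_subset_H2[OF f]] by simp
  finally show "cinner (C f) (T g) = 0" .
qed

text \<open>The conjugation turns multiplication by \<open>z\<close> into multiplication by its conjugate and maps \<open>e\<close>
  to the monomial of degree \<open>-1\<close>. Thus the correction term of the compressed shift becomes the
  one of the backward shift.\<close>

lemma conjugation_shift:
  assumes f: "f \<in> K"
  shows "C (S f) = backward_shift (C f)"
proof -
  define c where "c = cinner (mult_by (\<lambda>z. z) f) e"
  have "C e = monomial (- 1)"
  proof -
    have "C e = mult_by cnj (T (mult_by (\<lambda>z. cnj (radial_limit \<theta> z)) (monomial 0)))"
      by (simp add: conjugation_eq cnj_l2_mult_by unimodular_boundary cnj_l2_monomial T_unshift)
    then show ?thesis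
      by (simp add: mult_by_cnj_cancel unimodular_boundary unshift_monomial)
  qed
  moreover have "C (mult_by (\<lambda>z. z) f) = mult_by cnj (C f)"
    by (simp add: conjugation_eq cnj_l2_mult_by T_unshift)
  ultimately have "C (S f) = mult_by cnj (C f) - cnj c *\<^sub>C monomial (- 1)"
    by (simp add: compressed_shift_eq f conjugation_diff conjugation_linear c_def)
  moreover have "fourier_coeff (C f) 0 = cnj c"
  proof -
    have "fourier_coeff (C f) 0 = cinner e (mult_by (\<lambda>z. z) f)"
      by (simp add: fourier_coeff_def cinner_conjugation cnj_l2_monomial T_unshift cinner_unshift)
    then show ?thesis unfolding c_def by (subst (asm) cinner_commute)
  qed
  ultimately show ?thesis
    by (simp add: backward_shift_def mult_by_diff mult_by_scaleC unshift_monomial)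
qed

lemma conjugation_backward_shift:
  assumes f: "f \<in> K"
  shows "C (backward_shift f) = S (C f)"
proof -
  have "C (S (C f)) = backward_shift f"
    using conjugation_shift[OF conjugation_in_K[OF f]] by (simp add: conjugation_involution)
  then show ?thesis by (metis conjugation_involution)
qed


section \<open>The commutant of the compressed shift and its adjoint\<close>

text \<open>The defect operator of the adjoint has rank one: it sends \<open>f\<close> to \<open>f(0) k\<close>, where \<open>k\<close> is the
  reproducing kernel \<open>1 - cnj (\<theta> 0) \<theta>\<close> of the model space at the origin.\<close>

lemma compressed_shift_backward_shift:
  assumes f: "f \<in> K"
  shows "S (backward_shift f)
    = f - fourier_coeff f 0 *\<^sub>C (monomial 0 - cinner (monomial 0) e *\<^sub>C e)"
  using compressed_shift_eq[OF backward_shift_in_K[OF f]]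
  by (simp add: backward_shift_def cinner_diff_left cinner_scaleC_left cinner_e f
      scaleC_diff_right scaleC_scaleC flip: scaleC_minus_one)

text \<open>The compressed shift is irreducible. A linear map \<open>Y\<close> commuting with \<open>S\<close> and its adjoint
  commutes with the rank-one operator \<open>f \<mapsto> f(0) k\<close>, so it multiplies \<open>k\<close> by a scalar \<open>c\<close> and
  satisfies \<open>(Y f)(0) = c f(0)\<close>. The Taylor coefficients of \<open>f\<close> are the values at the origin of
  its iterated backward shifts, with which \<open>Y\<close> commutes; so every coefficient is multiplied by
  \<open>c\<close>.\<close>

theorem commutant_scalar:
  assumes Y: "\<And>f. f \<in> K \<Longrightarrow> Y f \<in> K"
    and add: "\<And>f g. f \<in> K \<Longrightarrow> g \<in> K \<Longrightarrow> Y (f + g) = Y f + Y g"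
    and scale: "\<And>c f. f \<in> K \<Longrightarrow> Y (c *\<^sub>C f) = c *\<^sub>C Y f"
    and shift: "\<And>f. f \<in> K \<Longrightarrow> Y (S f) = S (Y f)"
    and backward: "\<And>f. f \<in> K \<Longrightarrow> Y (backward_shift f) = backward_shift (Y f)"
  shows "\<exists>c. \<forall>f\<in>K. Y f = c *\<^sub>C f"
proof -
  have neg: "fourier_coeff f n = 0" if "f \<in> K" "n < 0" for f n
    using K_subset_H2[OF that(1)] that(2) by (simp add: mem_H2_iff)
  show ?thesis
  proof (cases "\<exists>p\<in>K. fourier_coeff p 0 \<noteq> 0")
    case False
    \<comment> \<open>If all functions of the space vanish at the origin, so do their iterated backward shifts,
      and the space is trivial.\<close>
    have "fourier_coeff f (int n) = 0" if "f \<in> K" for f n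
      using that
    proof (induction n arbitrary: f)
      case 0
      then show ?case using False by simp
    next
      case (Suc n)
      then show ?case
        using Suc.IH[OF backward_shift_in_K[OF Suc.prems]]
        by (simp add: fourier_coeff_backward_shift add.commute)
    qed
    then have "f = 0" if "f \<in> K" for f
      using that neg by (intro fourier_coeff_unique) (metis int_nat_eq not_less)
    then show ?thesis using Y by (intro exI[of _ 0]) simp
  next
    case True
    then obtain p where p: "p \<in> K" "fourier_coeff p 0 \<noteq> 0" by blast
    define k where "k = monomial 0 - cinner (monomial 0) e *\<^sub>C e"
    note SB = compressed_shift_backward_shift[folded k_def]
    \<comment> \<open>The rank-one operator maps the space into itself, and its value at \<open>p\<close> is a nonzero
      multiple of \<open>k\<close>.\<close>
    have "k = (1 / fourier_coeff p 0) *\<^sub>C (p - S (backward_shift p))"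
      using p by (simp add: SB scaleC_scaleC)
    moreover have "\<dots> \<in> K"
      by (intro K_closed compressed_shift_in_K backward_shift_in_K p)
    ultimately have k: "k \<in> K" by simp
    have "cinner p k = fourier_coeff p 0"
      by (simp add: k_def cinner_diff_right cinner_scaleC_right cinner_e p fourier_coeff_def)
    then have k0: "k \<noteq> 0" using p by auto
    have key: "fourier_coeff f 0 *\<^sub>C Y k = fourier_coeff (Y f) 0 *\<^sub>C k" if f: "f \<in> K" for f
    proof -
      have "Y f = Y (S (backward_shift f) + fourier_coeff f 0 *\<^sub>C k)"
        by (simp add: SB f)
      also have "\<dots> = Y (S (backward_shift f)) + fourier_coeff f 0 *\<^sub>C Y k"
        by (simp add: add scale k K_closed compressed_shift_in_K backward_shift_in_K f)
      also have "Y (S (backward_shift f)) = S (backward_shift (Y f))"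
        by (simp add: shift backward backward_shift_in_K f)
      also have "\<dots> = Y f - fourier_coeff (Y f) 0 *\<^sub>C k"
        by (simp add: SB Y f)
      finally show ?thesis by (simp add: algebra_simps)
    qed
    define c where "c = fourier_coeff (Y p) 0 / fourier_coeff p 0"
    have "Y k = (1 / fourier_coeff p 0) *\<^sub>C (fourier_coeff p 0 *\<^sub>C Y k)"
      using p by (simp add: scaleC_scaleC)
    also have "\<dots> = c *\<^sub>C k"
      unfolding key[OF p(1)] by (simp add: scaleC_scaleC c_def)
    finally have Yk: "Y k = c *\<^sub>C k" .
    have zero: "fourier_coeff (Y f) 0 = c * fourier_coeff f 0" if f: "f \<in> K" for f
    proof -
      have "(fourier_coeff (Y f) 0 - c * fourier_coeff f 0) *\<^sub>C k = 0"
        using key[OF f] by (simp add: Yk scaleC_diff_left scaleC_scaleC mult.commute)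
      then have "cmod (fourier_coeff (Y f) 0 - c * fourier_coeff f 0) * norm k = 0"
        by (metis norm_scaleC norm_zero)
      then show ?thesis using k0 by simp
    qed
    have coeffs: "fourier_coeff (Y f) (int n) = c * fourier_coeff f (int n)" if "f \<in> K" for f n
      using that
    proof (induction n arbitrary: f)
      case 0
      then show ?case using zero by simp
    next
      case (Suc n)
      then show ?case
        using Suc.IH[OF backward_shift_in_K[OF Suc.prems]]
        by (simp add: backward fourier_coeff_backward_shift add.commute)
    qed
    have "Y f = c *\<^sub>C f" if f: "f \<in> K" for f
    proof -
      have "fourier_coeff (Y f - c *\<^sub>C f) n = 0" for n
      proof (cases "n < 0")
        case True
        then show ?thesis by (simp add: fourier_coeff_linear neg Y f)
      next
        case False
        then have "n = int (nat n)" by simp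
        then obtain m where "n = int m" ..
        then show ?thesis using coeffs[OF f] by (simp add: fourier_coeff_linear)
      qed
      then have "Y f - c *\<^sub>C f = 0" by (rule fourier_coeff_unique)
      then show ?thesis by simp
    qed
    then show ?thesis by blast
  qed
qed

end

text \<open>Composing with the conjugation makes \<open>X\<close> complex linear and turns the two operator equations
  into commutation with \<open>S\<close> and its adjoint.\<close>

theorem theorem3p5:
  fixes \<theta> :: "complex \<Rightarrow> complex" and X :: "l2_circle \<Rightarrow> l2_circle"
  assumes "inner_function \<theta>"
    and "bounded_antilinear_on (model_space \<theta>) X"
  shows "((\<forall>f\<in>model_space \<theta>.
             adjoint_on (model_space \<theta>) (compressed_shift \<theta>) (X f) = X (compressed_shift \<theta> f)) \<and>
          (\<forall>f\<in>model_space \<theta>.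
             compressed_shift \<theta> (X f) = X (adjoint_on (model_space \<theta>) (compressed_shift \<theta>) f)))
    \<longleftrightarrow> (\<exists>c::complex. \<forall>f\<in>model_space \<theta>. X f = c *\<^sub>C model_conjugation \<theta> f)"
proof -
  interpret inner_multiplier \<theta> using assms(1) by unfold_locales
  have X: "\<And>f. f \<in> K \<Longrightarrow> X f \<in> K"
    and X_add: "\<And>f g. f \<in> K \<Longrightarrow> g \<in> K \<Longrightarrow> X (f + g) = X f + X g"
    and X_scale: "\<And>c f. f \<in> K \<Longrightarrow> X (c *\<^sub>C f) = cnj c *\<^sub>C X f"
    using assms(2) by (simp_all add: bounded_antilinear_on_def)
  show ?thesis
  proof
    assume "(\<forall>f\<in>K. adjoint_on K S (X f) = X (S f)) \<and> (\<forall>f\<in>K. S (X f) = X (adjoint_on K S f))"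
    then have 1: "backward_shift (X f) = X (S f)" and 2: "S (X f) = X (backward_shift f)"
      if "f \<in> K" for f
      using that X by (simp_all add: adjoint_compressed_shift)
    have "\<exists>c. \<forall>f\<in>K. C (X f) = c *\<^sub>C f"
    proof (rule commutant_scalar)
      fix f assume f: "f \<in> K"
      show "C (X f) \<in> K" by (intro conjugation_in_K X f)
      show "C (X (f + g)) = C (X f) + C (X g)" if "g \<in> K" for g
        by (simp add: X_add f that conjugation_linear)
      show "C (X (c *\<^sub>C f)) = c *\<^sub>C C (X f)" for c
        by (simp add: X_scale f conjugation_linear)
      show "C (X (S f)) = S (C (X f))"
        by (simp add: 1[OF f, symmetric] conjugation_backward_shift X f)
      show "C (X (backward_shift f)) = backward_shift (C (X f))"
        by (simp add: 2[OF f, symmetric] conjugation_shift X f)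
    qed
    then obtain c where c: "\<And>f. f \<in> K \<Longrightarrow> C (X f) = c *\<^sub>C f" by blast
    have "X f = cnj c *\<^sub>C C f" if "f \<in> K" for f
      using arg_cong[OF c[OF that], of C] by (simp add: conjugation_involution conjugation_linear)
    then show "\<exists>c. \<forall>f\<in>K. X f = c *\<^sub>C C f" by blast
  next
    assume "\<exists>c. \<forall>f\<in>K. X f = c *\<^sub>C C f"
    then obtain c where c: "\<And>f. f \<in> K \<Longrightarrow> X f = c *\<^sub>C C f" by blast
    have S_scale: "S (c *\<^sub>C f) = c *\<^sub>C S f" if "f \<in> K" for f
      using that by (simp add: compressed_shift_eq K_closed mult_by_scaleC cinner_scaleC_left
          scaleC_diff_right scaleC_scaleC)
    have B_scale: "backward_shift (c *\<^sub>C f) = c *\<^sub>C backward_shift f" for f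
      by (simp add: backward_shift_def fourier_coeff_linear mult_by_scaleC
          flip: scaleC_scaleC scaleC_diff_right)
    show "(\<forall>f\<in>K. adjoint_on K S (X f) = X (S f)) \<and> (\<forall>f\<in>K. S (X f) = X (adjoint_on K S f))"
      by (simp add: c adjoint_compressed_shift K_closed conjugation_in_K compressed_shift_in_K
          backward_shift_in_K S_scale B_scale conjugation_shift conjugation_backward_shift)
  qed
qed

end
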